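(* Let $N\ge 2$, let $a_1\le\cdots\le a_N$ be fixed real numbers, and for $\beta>0$ let $\lambda_1^{(\beta)}(t)\le\cdots\le\lambda_N^{(\beta)}(t)$ be the unique strong solution of the system of stochastic differential equations $$d\lambda_i(t)=\sqrt{\tfrac{2}{\beta}}\,db_i(t)+\sum_{j:\,j\ne i}\frac{1}{\lambda_i(t)-\lambda_j(t)}\,dt,\qquad \lambda_i(0)=a_i,\quad i=1,\dots,N,$$ subject to $\lambda_1(t)\le\cdots\le\lambda_N(t)$ almost surely, where $b_1,\dots,b_N$ are independent standard Brownian motions. Let $z_{1,N}^{(H)}<\dots<z_{N,N}^{(H)}$ be the zeros of the $N$th probabilist's Hermite polynomial $H_N$, and for $t\ge 0$ set $$(y_1(t),\dots,y_N(t))=(a_1,\dots,a_N)\boxplus_N\sqrt t\,(z_{1,N}^{(H)},\dots,z_{N,N}^{(H)}).$$ Then, for every $T>0$, as $\beta\to\infty$ with $N$ fixed, $\lambda_i^{(\beta)}(t)\to y_i(t)$ in probability uniformly for $t\in[0,T]$, for each $i=1,\dots,N$; that is, for every $\varepsilon>0$, $$\lim_{\beta\to\infty}\mathbb P\Big(\sup_{0\le t\le T}|\lambda_i^{(\beta)}(t)-y_i(t)|\ge\varepsilon\Big)=0 .$$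
   Context: $e_k(x_1,\dots,x_N)=\sum_{1\le j_1<\dots<j_k\le N}x_{j_1}\cdots x_{j_k}$ denotes the $k$th elementary symmetric polynomial, $e_0=1$. The finite free convolution of two $N$-tuples of real numbers, $(c_1,\dots,c_N)=(a_1,\dots,a_N)\boxplus_N(b_1,\dots,b_N)$, is the $N$-tuple of real numbers $c_1\le\dots\le c_N$ determined by $$e_k(c_1,\dots,c_N)=\sum_{i+j=k}\frac{(N-i)!\,(N-j)!}{N!\,(N-k)!}\,e_i(a_1,\dots,a_N)\,e_j(b_1,\dots,b_N),\qquad k=1,\dots,N$$ (it is known that the monic polynomial with these coefficients is real-rooted, so the $c_i$ exist). The probabilist's Hermite polynomials are the monic polynomials given by $H_0=1$, $H_1=x$, $H_{n+1}=xH_n-nH_{n-1}$ for $n\ge1$. It is known that the system of SDEs has a unique strong solution, and that for $\beta\ge1$ the $\lambda_i^{(\beta)}(t)$ are almost surely distinct for all $t>0$. *)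

theory Defs
  imports "HOL-Probability.Probability" "HOL-Computational_Algebra.Polynomial"
begin

text \<open>
  An \<open>N\<close>-tuple \<open>(x_1, ..., x_N)\<close> is a function on \<open>nat\<close> of which only the values on \<open>{1..N}\<close>
  matter. A system of \<open>N\<close> real processes is a function taking the index, the time and the outcome.
\<close>

definition elem_sym :: "nat \<Rightarrow> nat \<Rightarrow> (nat \<Rightarrow> real) \<Rightarrow> real" where
  "elem_sym N k x = (\<Sum>J | J \<subseteq> {1..N} \<and> card J = k. \<Prod>j\<in>J. x j)"

text \<open>
  \<open>is_finite_free_conv N a b c\<close> says that \<open>c\<close> is the finite free convolution of \<open>a\<close> and \<open>b\<close>. The
  conditions determine \<open>c\<close> on \<open>{1..N}\<close>: they fix the monic polynomial with roots \<open>c_1, ..., c_N\<close>,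
  and the roots are listed in increasing order.
\<close>

definition is_finite_free_conv ::
    "nat \<Rightarrow> (nat \<Rightarrow> real) \<Rightarrow> (nat \<Rightarrow> real) \<Rightarrow> (nat \<Rightarrow> real) \<Rightarrow> bool" where
  "is_finite_free_conv N a b c \<longleftrightarrow>
     mono_on {1..N} c \<and>
     (\<forall>k\<in>{1..N}. elem_sym N k c =
        (\<Sum>(i, j) | i + j = k.
           fact (N - i) * fact (N - j) / (fact N * fact (N - k)) * elem_sym N i a * elem_sym N j b))"

fun hermite_prob :: "nat \<Rightarrow> real poly" where
  "hermite_prob 0 = 1"
| "hermite_prob (Suc 0) = [:0, 1:]"
| "hermite_prob (Suc (Suc n)) =
     [:0, 1:] * hermite_prob (Suc n) - smult (real (Suc n)) (hermite_prob n)"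

definition standard_brownian_motion :: "'w measure \<Rightarrow> (real \<Rightarrow> 'w \<Rightarrow> real) \<Rightarrow> bool" where
  "standard_brownian_motion M b \<longleftrightarrow>
     prob_space M \<and>
     (\<forall>t\<ge>0. b t \<in> borel_measurable M) \<and>
     (AE w in M. b 0 w = 0) \<and>
     (\<forall>w\<in>space M. continuous_on {0..} (\<lambda>t. b t w)) \<and>
     (\<forall>s t. 0 \<le> s \<and> s < t \<longrightarrow>
        distributed M lborel (\<lambda>w. b t w - b s w) (normal_density 0 (sqrt (t - s)))) \<and>
     (\<forall>n. \<forall>t :: nat \<Rightarrow> real. 0 \<le> t 0 \<and> mono_on {..n} t \<longrightarrow>
        prob_space.indep_vars M (\<lambda>_. borel) (\<lambda>k w. b (t (Suc k)) w - b (t k) w) {..<n})"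

text \<open>Independence is independence of the whole paths, as elements of \<open>\<real>^[0, \<infinity>)\<close>.\<close>

definition independent_brownian_motions ::
    "'w measure \<Rightarrow> nat \<Rightarrow> (nat \<Rightarrow> real \<Rightarrow> 'w \<Rightarrow> real) \<Rightarrow> bool" where
  "independent_brownian_motions M N b \<longleftrightarrow>
     (\<forall>i\<in>{1..N}. standard_brownian_motion M (b i)) \<and>
     prob_space.indep_vars M (\<lambda>_. Pi\<^sub>M {0..} (\<lambda>_. borel))
       (\<lambda>i w. \<lambda>t\<in>{0..}. b i t w) {1..N}"

text \<open>The filtration generated by \<open>b_1, ..., b_N\<close>, augmented by the null sets of \<open>M\<close>.\<close>

definition brownian_filtration ::
    "'w measure \<Rightarrow> nat \<Rightarrow> (nat \<Rightarrow> real \<Rightarrow> 'w \<Rightarrow> real) \<Rightarrow> real \<Rightarrow> 'w measure" where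
  "brownian_filtration M N b t =
     sigma (space M)
       (null_sets M \<union> {b i s -` A \<inter> space M | i s A. i \<in> {1..N} \<and> s \<in> {0..t} \<and> A \<in> sets borel})"

text \<open>
  The noise is additive, so the stochastic differential equation is by definition the integral
  equation below, which contains no stochastic integral. In \<^typ>\<open>ennreal\<close> we have
  \<open>1 / 0 = \<infinity>\<close>; hence the finiteness condition says that the drift is absolutely
  integrable and also that for almost every time no two components coincide. The value
  \<open>1 / 0 = 0\<close> in \<^typ>\<open>real\<close> is therefore irrelevant in the integral equation.
\<close>

definition dyson_strong_solution ::
    "'w measure \<Rightarrow> nat \<Rightarrow> (nat \<Rightarrow> real) \<Rightarrow> real \<Rightarrow> (nat \<Rightarrow> real \<Rightarrow> 'w \<Rightarrow> real) \<Rightarrow>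
     (nat \<Rightarrow> real \<Rightarrow> 'w \<Rightarrow> real) \<Rightarrow> bool" where
  "dyson_strong_solution M N a \<beta> b x \<longleftrightarrow>
     (\<forall>i\<in>{1..N}. \<forall>t\<ge>0. x i t \<in> borel_measurable (brownian_filtration M N b t)) \<and>
     (\<forall>i\<in>{1..N}. \<forall>w\<in>space M. continuous_on {0..} (\<lambda>t. x i t w)) \<and>
     (AE w in M. \<forall>t\<ge>0. mono_on {1..N} (\<lambda>i. x i t w)) \<and>
     (AE w in M. \<forall>i\<in>{1..N}. x i 0 w = a i) \<and>
     (AE w in M. \<forall>i\<in>{1..N}. \<forall>j\<in>{1..N} - {i}. \<forall>t\<ge>0.
        (\<integral>\<^sup>+s\<in>{0..t}. 1 / ennreal \<bar>x i s w - x j s w\<bar> \<partial>lborel) < \<infinity>) \<and>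
     (AE w in M. \<forall>i\<in>{1..N}. \<forall>t\<ge>0.
        x i t w = a i + sqrt (2 / \<beta>) * b i t w
          + (LINT s:{0..t}|lborel. (\<Sum>j\<in>{1..N} - {i}. 1 / (x i s w - x j s w))))"

end

theory Submission
  imports Defs "HOL-Real_Asymp.Real_Asymp"
begin

text \<open>
  The proof is pathwise. Subtracting the noise from a path \<open>x\<close> gives an absolutely continuous path
  \<open>u\<close> with the drift of \<open>x\<close> as derivative, and \<open>x - u\<close> is uniformly small when \<open>\<beta>\<close> is large. For
  the drift without noise, the elementary symmetric polynomials satisfy the closed linear system
  \<open>e_k' = - (N - k + 2) (N - k + 1) / 2 * e_(k - 2)\<close>, and the convolution with the Hermite zeros is its
  explicit solution. Replacing \<open>x\<close> by \<open>u\<close> in the system costs at most a constant times the size of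
  the noise, because the time integral of \<open>\<Sum> 1 / \<bar>x_i - x_j\<bar>\<close> is bounded independently of \<open>\<beta>\<close>. Hence
  the elementary symmetric polynomials converge uniformly in time, and so do the ordered roots.
\<close>

section \<open>Elementary symmetric polynomials\<close>

text \<open>The drift is singular where components meet, and the \<open>a i\<close> may coincide, so
  the paths are not compared with their limit through a Lipschitz estimate. In the elementary
  symmetric polynomials the singularity disappears: after symmetrizing over pairs, the factor
  \<open>x i - x j\<close> cancels. The system obtained is triangular, level k driving level k + 2,
  so errors are propagated by finitely many integrations. The cancellation is exact only if drift
  and coefficients are both taken at \<open>x\<close>; coefficients taken at \<open>u\<close> leave
  an error of the order of the noise times the total inverse gap. To bound the time integral of that
  gap, the drift is weighted with the rank i: every pair then contributes with a fixed sign and a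
  factor of at least 1, while the integrated drift is a displacement of \<open>u\<close>. The
  displacement is controlled by \<Sum> u_i^2, which grows by at most N^2 per unit of time plus noise
  times the same gap. The circle closes because small noise lets the last term be absorbed. The way
  back from polynomials to roots is a compactness argument and gives no rate.\<close>

text \<open>The index set is a parameter because the partial derivative in \<open>x i\<close> is a
  polynomial in the remaining variables, over \<open>A - {i}\<close>, and because the proofs go by
  induction on the index set.\<close>

definition esym :: "nat set \<Rightarrow> nat \<Rightarrow> (nat \<Rightarrow> real) \<Rightarrow> real" where
  "esym A k x = (\<Sum>J | J \<subseteq> A \<and> card J = k. \<Prod>j\<in>J. x j)"

lemma elem_sym_eq_esym: "elem_sym N = esym {1..N}"
  by (simp add: elem_sym_def esym_def fun_eq_iff)

lemma esym_0 [simp]: "finite A \<Longrightarrow> esym A 0 x = 1"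
proof -
  assume "finite A"
  then have "{J. J \<subseteq> A \<and> card J = 0} = {{}}"
    by (auto dest: finite_subset)
  then show ?thesis by (simp add: esym_def)
qed

lemma esym_insert:
  assumes "finite A" "i \<notin> A"
  shows "esym (insert i A) (Suc k) x = esym A (Suc k) x + x i * esym A k x"
proof -
  let ?P = "\<lambda>k. {J. J \<subseteq> A \<and> card J = k}"
  have fin: "finite (?P k)" for k
    using assms by simp
  have eq: "{J. J \<subseteq> insert i A \<and> card J = Suc k} = ?P (Suc k) \<union> insert i ` ?P k" (is "?L = ?R")
  proof (intro set_eqI iffI)
    fix J assume "J \<in> ?L"
    then have J: "J \<subseteq> insert i A" "card J = Suc k" by auto
    show "J \<in> ?R"
    proof (cases "i \<in> J")
      case True
      then have "J = insert i (J - {i})" "J - {i} \<subseteq> A" "card (J - {i}) = k"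
        using J by auto
      then show ?thesis by blast
    next
      case False then show ?thesis using J by auto
    qed
  next
    fix J assume "J \<in> ?R"
    then consider "J \<in> ?P (Suc k)" | K where "K \<in> ?P k" "J = insert i K" by blast
    then show "J \<in> ?L"
    proof cases
      case 2
      then have "finite K" "i \<notin> K" using assms finite_subset by auto
      then show ?thesis using 2 by auto
    qed auto
  qed
  have "inj_on (insert i) (?P k)"
    using assms by (auto simp: inj_on_def)
  moreover have "?P (Suc k) \<inter> insert i ` ?P k = {}"
    using assms by auto
  moreover have "(\<Prod>j\<in>insert i J. x j) = x i * (\<Prod>j\<in>J. x j)" if "J \<in> ?P k" for J
    using that assms finite_subset by (subst prod.insert) auto
  ultimately show ?thesis
    unfolding esym_def eq using fin assms(1)
    by (subst sum.union_disjoint) (auto simp: sum.reindex sum_distrib_left)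
qed

lemma esym_remove:
  assumes "finite A" "i \<in> A"
  shows "esym A (Suc k) x = esym (A - {i}) (Suc k) x + x i * esym (A - {i}) k x"
  using esym_insert[of "A - {i}" i k x] assms by (simp add: insert_absorb)

lemma esym_eq_0: "finite A \<Longrightarrow> card A < k \<Longrightarrow> esym A k x = 0"
proof -
  assume "finite A" "card A < k"
  have "card J \<noteq> k" if "J \<subseteq> A" for J
    using card_mono[OF \<open>finite A\<close> that] \<open>card A < k\<close> by simp
  then have "{J. J \<subseteq> A \<and> card J = k} = {}" by blast
  then show ?thesis by (simp only: esym_def sum.empty)
qed

text \<open>Double counting: a k-element set J survives the removal of exactly those
  \<open>card A - k\<close> indices that lie outside J. The factor is a difference of reals and is
  never truncated; for k above \<open>card A\<close> both sides vanish.\<close>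

lemma sum_esym_remove:
  assumes "finite A"
  shows "(\<Sum>i\<in>A. esym (A - {i}) k x) = (real (card A) - real k) * esym A k x"
  using assms
proof (induction A arbitrary: k rule: finite_induct)
  case empty
  show ?case
    by (cases k) (auto simp: esym_eq_0)
next
  case (insert i A)
  show ?case
  proof (cases k)
    case 0
    then show ?thesis using insert by simp
  next
    case (Suc n)
    have "esym (insert i A - {j}) k x = esym (A - {j}) k x + x i * esym (A - {j}) n x"
      if "j \<in> A" for j
    proof -
      have "insert i A - {j} = insert i (A - {j})" using that insert by auto
      then show ?thesis using that insert Suc esym_insert[of "A - {j}" i n x] by simp
    qed
    then have *: "(\<Sum>j\<in>insert i A. esym (insert i A - {j}) k x) =
      esym A k x + ((\<Sum>j\<in>A. esym (A - {j}) k x) + x i * (\<Sum>j\<in>A. esym (A - {j}) n x))"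
      using insert.hyps by (simp add: sum.distrib sum_distrib_left)
    show ?thesis
      unfolding * insert.IH using insert.hyps Suc by (simp add: esym_insert algebra_simps)
  qed
qed

section \<open>Action of the repulsive drift on the elementary symmetric polynomials\<close>

lemma sum_antisym:
  fixes f :: "'a \<Rightarrow> real" and g :: "'a \<Rightarrow> 'a \<Rightarrow> real"
  assumes "finite A" and "\<And>i j. g j i = - g i j"
  shows "(\<Sum>i\<in>A. f i * (\<Sum>j\<in>A - {i}. g i j)) = (\<Sum>i\<in>A. \<Sum>j\<in>A - {i}. (f i - f j) * g i j) / 2"
proof -
  \<comment> \<open>The inner range depends on \<open>i\<close>; padding the diagonal with zeros
    gives a full square, over which the order of summation can be exchanged.\<close>
  have D: "(\<Sum>i\<in>A. \<Sum>j\<in>A - {i}. h i j) = (\<Sum>i\<in>A. \<Sum>j\<in>A. if i = j then 0 else h i j)"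
    for h :: "'a \<Rightarrow> 'a \<Rightarrow> real"
    using assms(1) by (intro sum.cong refl sum.mono_neutral_cong_left) auto
  have S: "(\<Sum>i\<in>A. \<Sum>j\<in>A - {i}. f j * g i j) = - (\<Sum>i\<in>A. \<Sum>j\<in>A - {i}. f i * g i j)"
  proof -
    have "(\<Sum>i\<in>A. \<Sum>j\<in>A. if i = j then 0 else f j * g i j) =
        (\<Sum>i\<in>A. \<Sum>j\<in>A. if j = i then 0 else f i * g j i)"
      by (rule sum.swap)
    also have "\<dots> = (\<Sum>i\<in>A. \<Sum>j\<in>A. - (if i = j then 0 else f i * g i j))"
    proof (intro sum.cong refl)
      fix i j
      show "(if j = i then 0 else f i * g j i) = - (if i = j then 0 else f i * g i j)"
        using assms(2)[of i j] by auto
    qed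
    finally show ?thesis unfolding D by (simp only: sum_negf)
  qed
  have "(\<Sum>i\<in>A. \<Sum>j\<in>A - {i}. (f i - f j) * g i j) =
      (\<Sum>i\<in>A. \<Sum>j\<in>A - {i}. f i * g i j) - (\<Sum>i\<in>A. \<Sum>j\<in>A - {i}. f j * g i j)"
    by (simp add: left_diff_distrib sum_subtractf)
  also have "\<dots> = 2 * (\<Sum>i\<in>A. f i * (\<Sum>j\<in>A - {i}. g i j))"
    unfolding S by (simp add: sum_distrib_left)
  finally show ?thesis by simp
qed

text \<open>As the partial derivative of e_(k+2) in \<open>x i\<close> is e_(k+1) of the other
  variables, the left side is the derivative of e_(k+2) along the drift. Symmetrized over pairs it
  contains the difference of e_(k+1) without i and without j, which is \<open>- (x i - x j)\<close>
  times e_k without both, so the denominator cancels. Counting the two removals gives the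
  factor.\<close>

lemma drift_esym:
  assumes "finite A" and "inj_on x A"
  shows "(\<Sum>i\<in>A. esym (A - {i}) (Suc k) x * (\<Sum>j\<in>A - {i}. 1 / (x i - x j))) =
    - ((real (card A) - real k) * (real (card A) - real k - 1) / 2) * esym A k x"
proof -
  have "(esym (A - {i}) (Suc k) x - esym (A - {j}) (Suc k) x) * (1 / (x i - x j)) =
      - esym (A - {i} - {j}) k x" if "i \<in> A" "j \<in> A - {i}" for i j
  proof -
    have cancel: "e * - d * (1 / d) = - e" if "d \<noteq> 0" for d e :: real
      using that by simp
    have nz: "x i - x j \<noteq> 0" using assms that by (auto simp: inj_on_def)
    have "A - {j} - {i} = A - {i} - {j}" by auto
    then have *: "esym (A - {i}) (Suc k) x - esym (A - {j}) (Suc k) x =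
      esym (A - {i} - {j}) k x * - (x i - x j)"
      using esym_remove[of "A - {i}" j k x] esym_remove[of "A - {j}" i k x] that assms
      by (simp add: algebra_simps)
    show ?thesis unfolding * using nz by (rule cancel)
  qed
  note pair = this
  have "(\<Sum>i\<in>A. esym (A - {i}) (Suc k) x * (\<Sum>j\<in>A - {i}. 1 / (x i - x j))) =
    (\<Sum>i\<in>A. \<Sum>j\<in>A - {i}. (esym (A - {i}) (Suc k) x - esym (A - {j}) (Suc k) x) * (1 / (x i - x j))) / 2"
    by (intro sum_antisym assms(1)) (metis minus_diff_eq minus_divide_right)
  also have "\<dots> = (\<Sum>i\<in>A. \<Sum>j\<in>A - {i}. - esym (A - {i} - {j}) k x) / 2"
    by (intro arg_cong2[of _ _ _ _ "(/)"] sum.cong refl pair)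
  also have "\<dots> = - (\<Sum>i\<in>A. (real (card A) - 1 - real k) * esym (A - {i}) k x) / 2"
  proof -
    have "real (card (A - {i})) = real (card A) - 1" if "i \<in> A" for i
    proof -
      have "card A > 0" using that assms card_gt_0_iff by blast
      then show ?thesis using that by (simp add: card_Diff_singleton of_nat_diff Suc_leI)
    qed
    then show ?thesis using assms by (simp add: sum_negf sum_esym_remove)
  qed
  also have "\<dots> = - ((real (card A) - 1 - real k) * ((real (card A) - real k) * esym A k x)) / 2"
    by (simp add: sum_distrib_left[symmetric] sum_esym_remove assms)
  also have "\<dots> = - ((real (card A) - real k) * (real (card A) - real k - 1) / 2) * esym A k x"
    by (simp add: field_simps)
  finally show ?thesis .
qed

text \<open>Bounds a tuple by its first two elementary symmetric polynomials. For \<open>y t\<close>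
  the first is constant and the second continuous in time, so \<open>y\<close> is bounded on a
  finite time interval.\<close>

lemma sum_squares_esym:
  "finite A \<Longrightarrow> (\<Sum>i\<in>A. (x i)\<^sup>2) = (esym A 1 x)\<^sup>2 - 2 * esym A 2 x"
  by (induction A rule: finite_induct)
    (auto simp: esym_eq_0 esym_insert numeral_2_eq_2 power2_eq_square algebra_simps)

lemma esym_cmult: "esym A k (\<lambda>i. c * x i) = c ^ k * esym A k x"
  unfolding esym_def by (auto simp: prod.distrib sum_distrib_left intro!: sum.cong)

section \<open>Elementary symmetric polynomials as coefficients\<close>

text \<open>Vieta's formula, by induction on the index set: in the product with a new linear factor,
  one summand shifts the exponent and the other raises k, and the two recombine through
  \<open>esym_insert\<close>.\<close>

lemma prod_linear_poly:
  assumes "finite A"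
  shows "(\<Prod>i\<in>A. [:- x i, 1:]) = (\<Sum>k\<le>card A. monom ((-1) ^ k * esym A k x) (card A - k))"
  using assms
proof (induction A rule: finite_induct)
  case empty
  show ?case by simp
next
  case (insert i A)
  let ?n = "card A"
  let ?m = "\<lambda>n k. monom ((-1) ^ k * esym A k x) (n - k)"
  have X: "[:- x i, 1:] * p = monom 1 1 * p + monom (- x i) 0 * p" for p :: "real poly"
    by (simp add: monom_altdef)
  have "(\<Prod>j\<in>insert i A. [:- x j, 1:]) = [:- x i, 1:] * (\<Prod>j\<in>A. [:- x j, 1:])"
    using insert by simp
  also have "\<dots> = (\<Sum>k\<le>?n. monom 1 1 * ?m ?n k) + (\<Sum>k\<le>?n. monom (- x i) 0 * ?m ?n k)"
    by (simp only: X insert.IH sum_distrib_left sum.distrib)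
  also have "\<dots> = (\<Sum>k\<le>?n. ?m (Suc ?n) k) +
      (\<Sum>k\<le>?n. monom ((-1) ^ Suc k * (x i * esym A k x)) (?n - k))"
    by (intro arg_cong2[of _ _ _ _ "(+)"] sum.cong) (auto simp: mult_monom Suc_diff_le)
  also have "(\<Sum>k\<le>?n. ?m (Suc ?n) k) =
      monom 1 (Suc ?n) + (\<Sum>k\<le>?n. monom ((-1) ^ Suc k * esym A (Suc k) x) (?n - k))"
  proof -
    \<comment> \<open>The added term is 0 because its \<open>k\<close> exceeds
      \<open>card A\<close>; with it, the term at 0 can be split off as the leading
      monomial.\<close>
    have "(\<Sum>k\<le>?n. ?m (Suc ?n) k) = (\<Sum>k\<le>Suc ?n. ?m (Suc ?n) k)"
      using insert.hyps by (simp add: esym_eq_0)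
    also have "\<dots> = monom 1 (Suc ?n) + (\<Sum>k\<le>?n. monom ((-1) ^ Suc k * esym A (Suc k) x) (?n - k))"
      using insert.hyps by (subst sum.atMost_Suc_shift) simp
    finally show ?thesis .
  qed
  also have "\<dots> + (\<Sum>k\<le>?n. monom ((-1) ^ Suc k * (x i * esym A k x)) (?n - k)) = monom 1 (Suc ?n) +
      (\<Sum>k\<le>?n. monom ((-1) ^ Suc k * esym (insert i A) (Suc k) x) (?n - k))"
    by (simp only: add.assoc sum.distrib[symmetric] add_monom esym_insert[OF insert.hyps] distrib_left)
  also have "\<dots> = (\<Sum>k\<le>Suc ?n. monom ((-1) ^ k * esym (insert i A) k x) (Suc ?n - k))"
    using insert.hyps by (subst sum.atMost_Suc_shift) simp
  finally show ?case using insert.hyps by (simp del: sum.atMost_Suc)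
qed

lemma coeff_prod_linear_poly:
  assumes "finite A" "k \<le> card A"
  shows "coeff (\<Prod>i\<in>A. [:- x i, 1:]) (card A - k) = (-1) ^ k * esym A k x"
proof -
  have "coeff (\<Prod>i\<in>A. [:- x i, 1:]) (card A - k) =
      (\<Sum>j\<le>card A. if j = k then (-1) ^ j * esym A j x else 0)"
    unfolding prod_linear_poly[OF assms(1)] coeff_sum coeff_monom
    using assms by (intro sum.cong) auto
  then show ?thesis using assms by (simp add: sum.delta)
qed

section \<open>Hermite polynomials\<close>

text \<open>The raising relation and the Appell property are proved together, since the inductive
  step differentiates the three-term recursion and needs both.\<close>

lemma hermite_prob_Suc:
  "hermite_prob (Suc n) = [:0, 1:] * hermite_prob n - pderiv (hermite_prob n) \<and>
   pderiv (hermite_prob (Suc n)) = smult (real (Suc n)) (hermite_prob n)"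
proof (induction n)
  case 0
  show ?case by (simp add: pderiv_pCons)
next
  case (Suc n)
  have 1: "hermite_prob (Suc (Suc n)) =
      [:0, 1:] * hermite_prob (Suc n) - pderiv (hermite_prob (Suc n))"
    using Suc by (metis hermite_prob.simps(3))
  have X: "pderiv ([:0, 1:] * p) = p + [:0, 1:] * pderiv p" for p :: "real poly"
    by (simp add: pderiv_mult pderiv_pCons)
  have "pderiv (hermite_prob (Suc (Suc n))) =
      hermite_prob (Suc n) + [:0, 1:] * smult (real (Suc n)) (hermite_prob n)
        - smult (real (Suc n)) (pderiv (hermite_prob n))"
    unfolding hermite_prob.simps(3) pderiv_diff pderiv_smult X Suc[THEN conjunct2] ..
  also have "\<dots> = hermite_prob (Suc n) +
      smult (real (Suc n)) ([:0, 1:] * hermite_prob n - pderiv (hermite_prob n))"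
    by (simp add: smult_diff_right)
  also have "\<dots> = hermite_prob (Suc n) + smult (real (Suc n)) (hermite_prob (Suc n))"
    using Suc by simp
  also have "\<dots> = smult (real (Suc (Suc n))) (hermite_prob (Suc n))"
    by (metis add.commute of_nat_Suc smult_add_left smult_1_left)
  finally show ?case using 1 by blast
qed

lemma hermite_prob_ode:
  "pderiv (pderiv (hermite_prob n)) = [:0, 1:] * pderiv (hermite_prob n) - smult (real n) (hermite_prob n)"
proof -
  have "smult (real (Suc n)) (hermite_prob n) =
      hermite_prob n + [:0, 1:] * pderiv (hermite_prob n) - pderiv (pderiv (hermite_prob n))"
    using hermite_prob_Suc[of n]
    by (metis (no_types, lifting) add.commute add_0 add_diff_eq mult.commute mult_1 mult_zero_right
      one_pCons pCons_0_0 pderiv_1 pderiv_diff pderiv_mult pderiv_pCons)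
  then show ?thesis by (simp add: smult_add_left algebra_simps)
qed

lemma coeff_hermite_prob_rec:
  "real ((k + 1) * (k + 2)) * coeff (hermite_prob n) (k + 2) = (real k - real n) * coeff (hermite_prob n) k"
proof -
  have "coeff (pderiv (pderiv (hermite_prob n))) k =
      coeff ([:0, 1:] * pderiv (hermite_prob n)) k - real n * coeff (hermite_prob n) k"
    by (subst hermite_prob_ode) simp
  then show ?thesis
    by (cases k) (simp_all add: coeff_pderiv coeff_pCons algebra_simps)
qed

lemma degree_hermite_prob: "degree (hermite_prob n) = n \<and> coeff (hermite_prob n) n = 1"
proof (induction n)
  case 0
  show ?case by simp
next
  case (Suc n)
  have "degree (pderiv (hermite_prob n)) \<le> n - 1"
    using Suc by (simp add: degree_pderiv)
  then have d: "degree (pderiv (hermite_prob n)) < Suc n" by simp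
  have c: "coeff (pderiv (hermite_prob n)) k = 0" if "k > n" for k
    using d that by (simp add: coeff_eq_0)
  have "coeff (hermite_prob (Suc n)) (Suc n) = 1"
    using hermite_prob_Suc[of n] Suc c[of "Suc n"] by (simp add: coeff_pCons)
  moreover have "degree (hermite_prob (Suc n)) \<le> Suc n"
    using Suc c unfolding hermite_prob_Suc[of n, THEN conjunct1]
    by (intro degree_le allI impI) (auto simp: coeff_pCons coeff_eq_0 split: nat.split)
  ultimately show ?case by (metis le_antisym le_degree one_neq_zero)
qed

text \<open>\<open>z\<close> lists the zeros without repetition, so the product of the linear
  factors divides the polynomial. Both are monic of degree \<open>card A\<close>, hence the quotient
  is 1.\<close>

lemma hermite_prob_eq_prod:
  fixes A :: "nat set"
  assumes "inj_on z A" "finite A" "z ` A = {x. poly (hermite_prob (card A)) x = 0}"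
  shows "hermite_prob (card A) = (\<Prod>i\<in>A. [:- z i, 1:])"
proof -
  have "(\<Prod>i\<in>A. [:- z i, 1:]) = (\<Prod>x\<in>z ` A. [:- x, 1:])"
    by (simp add: prod.reindex[OF assms(1)])
  moreover have "(\<Prod>x\<in>z ` A. [:- x, 1:]) dvd hermite_prob (card A)"
  proof -
    have *: "(\<Prod>x\<in>B. [:- x, 1:]) dvd p" if "finite B" "\<forall>x\<in>B. poly p x = 0"
      for B and p :: "real poly"
      using that
    proof (induction B arbitrary: p rule: finite_induct)
      case (insert x B)
      then obtain q where q: "p = [:- x, 1:] * q"
        by (meson dvdE insertI1 poly_eq_0_iff_dvd)
      have "\<forall>y\<in>B. poly q y = 0"
        using insert q by force
      then have "(\<Prod>x\<in>B. [:- x, 1:]) dvd q" by (rule insert.IH)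
      then show ?case
        unfolding q prod.insert[OF insert.hyps] by (rule mult_dvd_mono[OF dvd_refl])
    qed simp
    show ?thesis by (rule *[OF finite_imageI[OF assms(2)]]) (simp add: assms(3))
  qed
  moreover have "coeff (\<Prod>i\<in>A. [:- z i, 1:]) (card A) = 1" "degree (\<Prod>i\<in>A. [:- z i, 1:]) = card A"
    using coeff_prod_linear_poly[of A 0 z] assms(2)
    by (simp_all add: degree_prod_eq_sum_degree)
  ultimately obtain q where q: "hermite_prob (card A) = (\<Prod>i\<in>A. [:- z i, 1:]) * q"
    by (metis dvdE)
  have nz: "hermite_prob (card A) \<noteq> 0"
    using degree_hermite_prob[of "card A"] by auto
  then have "degree q = 0"
    using q degree_hermite_prob[of "card A"] \<open>degree (\<Prod>i\<in>A. [:- z i, 1:]) = card A\<close>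
    by (metis add_cancel_left_right degree_mult_eq mult_eq_0_iff)
  then obtain c where "q = [:c:]" by (metis degree_eq_zeroE)
  moreover have "coeff (hermite_prob (card A)) (card A) = c"
    unfolding q \<open>q = [:c:]\<close> using \<open>coeff (\<Prod>i\<in>A. [:- z i, 1:]) (card A) = 1\<close> by simp
  then have "c = 1"
    using degree_hermite_prob by simp
  ultimately show ?thesis using q by (simp add: one_pCons)
qed

text \<open>Vieta's formula turns Hermite's differential equation, read off at the exponent
  \<open>card A - (j + 2)\<close>, into a two-step recursion. Started from e_1 = 0, it makes all odd
  e_j of the zeros vanish.\<close>

lemma esym_hermite_zeros:
  fixes A :: "nat set"
  assumes "inj_on z A" "finite A" "z ` A = {x. poly (hermite_prob (card A)) x = 0}"
  shows "card A > 0 \<Longrightarrow> esym A 1 z = 0"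
    and "j + 2 \<le> card A \<Longrightarrow> real (j + 2) * esym A (j + 2) z =
      - ((real (card A) - real j) * (real (card A) - real j - 1)) * esym A j z"
proof -
  let ?n = "card A"
  have c: "coeff (hermite_prob ?n) (?n - k) = (-1) ^ k * esym A k z" if "k \<le> ?n" for k
    using hermite_prob_eq_prod[OF assms] coeff_prod_linear_poly[OF assms(2) that] by simp
  show "esym A 1 z = 0" if "?n > 0"
  proof -
    \<comment> \<open>One place above the degree the coefficient is 0; the recursion at exponent
      \<open>?n - 1\<close>, where its factor is -1, then kills the next-to-leading
      coefficient.\<close>
    have "coeff (hermite_prob ?n) (?n + 1) = 0"
      using degree_hermite_prob[of ?n] by (intro coeff_eq_0) auto
    then have "coeff (hermite_prob ?n) (?n - 1) = 0"
      using coeff_hermite_prob_rec[of "?n - 1" ?n] that by (simp add: of_nat_diff)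
    then show ?thesis using c[of 1] that by simp
  qed
  show "real (j + 2) * esym A (j + 2) z =
      - ((real ?n - real j) * (real ?n - real j - 1)) * esym A j z" if "j + 2 \<le> ?n"
  proof -
    have e: "?n - (j + 2) + 2 = ?n - j" "?n - (j + 2) + 1 = ?n - j - 1" using that by auto
    have r: "real (?n - j) = real ?n - real j" "real (?n - j - 1) = real ?n - real j - 1"
      "real (?n - (j + 2)) - real ?n = - real (j + 2)"
      using that by (simp_all add: of_nat_diff)
    have "(real ?n - real j - 1) * (real ?n - real j) * ((-1) ^ j * esym A j z) =
        - real (j + 2) * ((-1) ^ (j + 2) * esym A (j + 2) z)"
      using coeff_hermite_prob_rec[of "?n - (j + 2)" ?n] c[of j] c[of "j + 2"] that
      unfolding e of_nat_mult r by simp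
    then have "(-1) ^ j * (real (j + 2) * esym A (j + 2) z) = (-1) ^ j *
        (- ((real ?n - real j) * (real ?n - real j - 1)) * esym A j z)"
      by (simp add: algebra_simps)
    then show ?thesis by (subst (asm) mult_left_cancel) simp_all
  qed
qed

section \<open>Indefinite Lebesgue integrals\<close>

text \<open>Absolute continuity in the form of an indefinite integral. The density is carried along
  explicitly because the drift is meaningful only for almost every time, so no pointwise derivative
  is available.\<close>

definition abs_cont_on :: "real \<Rightarrow> (real \<Rightarrow> real) \<Rightarrow> (real \<Rightarrow> real) \<Rightarrow> bool" where
  "abs_cont_on T u f \<longleftrightarrow> set_integrable lborel {0..T} f \<and>
     (\<forall>t\<in>{0..T}. u t = u 0 + (LINT s:{0..t}|lborel. f s))"

lemma abs_cont_onI: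
  assumes "set_integrable lborel {0..T} f"
    and "\<And>t. 0 \<le> t \<Longrightarrow> t \<le> T \<Longrightarrow> u t = u 0 + (LINT s:{0..t}|lborel. f s)"
  shows "abs_cont_on T u f"
  unfolding abs_cont_on_def by (metis assms atLeastAtMost_iff)

lemma abs_cont_onD:
  assumes "abs_cont_on T u f" "0 \<le> t" "t \<le> T"
  shows "u t = u 0 + (LINT s:{0..t}|lborel. f s)"
  by (metis assms abs_cont_on_def atLeastAtMost_iff)

lemma abs_cont_on_integrable:
  assumes "abs_cont_on T u f" "t \<le> T"
  shows "set_integrable lborel {0..t} f"
  by (rule set_integrable_subset[OF assms(1)[unfolded abs_cont_on_def, THEN conjunct1]]) (use assms(2) in auto)

lemma abs_cont_on_const: "abs_cont_on T (\<lambda>_. c) (\<lambda>_. 0)"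
  by (simp add: abs_cont_on_def set_integrable_def set_lebesgue_integral_def)

lemma abs_cont_on_add:
  assumes "abs_cont_on T u f" "abs_cont_on T v g"
  shows "abs_cont_on T (\<lambda>t. u t + v t) (\<lambda>t. f t + g t)"
proof (rule abs_cont_onI)
  show "set_integrable lborel {0..T} (\<lambda>t. f t + g t)"
    using assms by (intro set_integral_add abs_cont_on_integrable) auto
  fix t assume "0 \<le> t" "t \<le> T"
  then show "u t + v t = u 0 + v 0 + (LINT s:{0..t}|lborel. f s + g s)"
    using abs_cont_onD[OF assms(1), of t] abs_cont_onD[OF assms(2), of t]
      abs_cont_on_integrable[OF assms(1), of t] abs_cont_on_integrable[OF assms(2), of t] by simp
qed

lemma abs_cont_on_cmult:
  assumes "abs_cont_on T u f"
  shows "abs_cont_on T (\<lambda>t. c * u t) (\<lambda>t. c * f t)"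
proof (rule abs_cont_onI)
  show "set_integrable lborel {0..T} (\<lambda>t. c * f t)"
    using assms by (intro set_integrable_mult_right abs_cont_on_integrable) auto
  fix t assume "0 \<le> t" "t \<le> T"
  then show "c * u t = c * u 0 + (LINT s:{0..t}|lborel. c * f s)"
    using abs_cont_onD[OF assms, of t] by (simp add: algebra_simps)
qed

lemma abs_cont_on_diff:
  assumes "abs_cont_on T u f" "abs_cont_on T v g"
  shows "abs_cont_on T (\<lambda>t. u t - v t) (\<lambda>t. f t - g t)"
  using abs_cont_on_add[OF assms(1) abs_cont_on_cmult[OF assms(2), of "-1"]] by simp

lemma abs_cont_on_sum:
  assumes "\<And>i. i \<in> A \<Longrightarrow> abs_cont_on T (u i) (f i)"
  shows "abs_cont_on T (\<lambda>t. \<Sum>i\<in>A. u i t) (\<lambda>t. \<Sum>i\<in>A. f i t)"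
  using assms
  by (induction A rule: infinite_finite_induct)
    (auto simp: abs_cont_on_const intro: abs_cont_on_add)

lemma abs_cont_on_continuous:
  assumes "abs_cont_on T u f"
  shows "continuous_on {0..T} u"
proof -
  have i: "set_integrable lborel {0..t} f" if "t \<le> T" for t
    using assms that by (rule abs_cont_on_integrable)
  have "f integrable_on {0..T}"
    using i[of T] by (intro set_borel_integral_eq_integral) simp
  then have "continuous_on {0..T} (\<lambda>t. u 0 + integral {0..t} f)"
    by (intro continuous_intros indefinite_integral_continuous_1)
  then show ?thesis
  proof (rule continuous_on_eq)
    fix t assume "t \<in> {0..T}"
    then show "u 0 + integral {0..t} f = u t"
      using abs_cont_onD[OF assms, of t] set_borel_integral_eq_integral(2)[OF i[of t]] by simp
  qed
qed

section \<open>Integration by parts\<close>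

lemma set_integrable_mult_continuous:
  fixes f g :: "real \<Rightarrow> real"
  assumes "set_integrable lborel {a..b} f" "continuous_on {a..b} g"
  shows "set_integrable lborel {a..b} (\<lambda>s. g s * f s)"
proof -
  obtain B where B: "\<forall>s\<in>{a..b}. \<bar>g s\<bar> \<le> B"
    using compact_imp_bounded[OF compact_continuous_image[OF assms(2)]]
    by (auto simp: bounded_iff)
  have g: "(\<lambda>s. indicator {a..b} s *\<^sub>R g s) \<in> borel_measurable lborel"
    using borel_measurable_continuous_on_indicator[OF _ assms(2)] by simp
  have "integrable lborel (\<lambda>s. (indicator {a..b} s *\<^sub>R g s) * (indicator {a..b} s *\<^sub>R f s))"
  proof (rule Bochner_Integration.integrable_bound)
    show "integrable lborel (\<lambda>s. B * (indicator {a..b} s *\<^sub>R f s))"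
      using assms(1) unfolding set_integrable_def by (rule integrable_mult_right)
    show "(\<lambda>s. (indicator {a..b} s *\<^sub>R g s) * (indicator {a..b} s *\<^sub>R f s)) \<in> borel_measurable lborel"
      using g borel_measurable_integrable[OF assms(1)[unfolded set_integrable_def]]
      by (rule borel_measurable_times)
    show "AE s in lborel. norm ((indicator {a..b} s *\<^sub>R g s) * (indicator {a..b} s *\<^sub>R f s)) \<le>
        norm (B * (indicator {a..b} s *\<^sub>R f s))"
    proof (intro AE_I2)
      fix s
      show "norm ((indicator {a..b} s *\<^sub>R g s) * (indicator {a..b} s *\<^sub>R f s)) \<le>
        norm (B * (indicator {a..b} s *\<^sub>R f s))"
      proof (cases "s \<in> {a..b}")
        case True
        then have "\<bar>g s\<bar> \<le> \<bar>B\<bar>" using B by fastforce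
        then show ?thesis using True by (simp add: abs_mult mult_right_mono)
      qed simp
    qed
  qed
  moreover have "(indicator {a..b} s *\<^sub>R g s) * (indicator {a..b} s *\<^sub>R f s) =
      indicator {a..b} s *\<^sub>R (g s * f s)" for s
    by (auto simp: indicator_def)
  ultimately show ?thesis unfolding set_integrable_def by (simp only:)
qed

text \<open>By Fubini the product is the integral of f(s) g(r) over the plane, which is cut along
  the diagonal.\<close>

lemma integral_product_triangles:
  fixes f g :: "real \<Rightarrow> real"
  assumes f: "integrable lborel f" and g: "integrable lborel g"
  shows "integral\<^sup>L lborel f * integral\<^sup>L lborel g =
    (\<integral>s. f s * (\<integral>r. indicator {..s} r * g r \<partial>lborel) \<partial>lborel) +
    (\<integral>s. g s * (\<integral>r. indicator {..s} r * f r \<partial>lborel) \<partial>lborel)"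
proof -
  note [measurable] = borel_measurable_integrable[OF f] borel_measurable_integrable[OF g]
  have [measurable]: "Measurable.pred (borel \<Otimes>\<^sub>M borel) (\<lambda>x :: real \<times> real. fst x < snd x)"
    "Measurable.pred (borel \<Otimes>\<^sub>M borel) (\<lambda>x :: real \<times> real. snd x \<le> fst x)"
    by measurable
  have m: "(\<lambda>(s, r). f s * g r) \<in> borel_measurable (lborel \<Otimes>\<^sub>M lborel)"
    by measurable
  have i: "integrable (lborel \<Otimes>\<^sub>M lborel) (\<lambda>(s, r). f s * g r)"
    using f g by (intro lborel_pair.Fubini_integrable) (simp_all add: abs_mult)
  have i1: "integrable (lborel \<Otimes>\<^sub>M lborel) (\<lambda>(s, r). f s * (indicator {..s} r * g r))"
    by (rule Bochner_Integration.integrable_bound[OF i])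
      (auto simp: indicator_def split_beta' abs_mult)
  have i2: "integrable (lborel \<Otimes>\<^sub>M lborel) (\<lambda>(s, r). g r * (indicator {..<r} s * f s))"
    by (rule Bochner_Integration.integrable_bound[OF i])
      (auto simp: indicator_def split_beta' abs_mult)
  \<comment> \<open>The cut puts the diagonal into the first triangle only. A single point is a null
    set, so the second triangle may be closed as well.\<close>
  have inner: "(\<integral>s. g r * (indicator {..<r} s * f s) \<partial>lborel) =
      g r * (\<integral>s. indicator {..r} s * f s \<partial>lborel)" for r
  proof -
    have "AE s in lborel. s \<noteq> r"
      by (rule AE_lborel_singleton)
    then have "(\<integral>s. indicator {..<r} s * f s \<partial>lborel) = (\<integral>s. indicator {..r} s * f s \<partial>lborel)"
      by (intro integral_cong_AE) (auto simp: indicator_def)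
    then show ?thesis by simp
  qed
  have "integral\<^sup>L lborel f * integral\<^sup>L lborel g = (\<integral>s. (\<integral>r. f s * g r \<partial>lborel) \<partial>lborel)"
    by simp
  also have "\<dots> = integral\<^sup>L (lborel \<Otimes>\<^sub>M lborel) (\<lambda>(s, r). f s * g r)"
    using lborel_pair.integral_fst'[OF i] by simp
  also have "\<dots> = integral\<^sup>L (lborel \<Otimes>\<^sub>M lborel)
      (\<lambda>x. (case x of (s, r) \<Rightarrow> f s * (indicator {..s} r * g r)) + (case x of (s, r) \<Rightarrow> g r * (indicator {..<r} s * f s)))"
    by (intro Bochner_Integration.integral_cong) (auto simp: indicator_def)
  also have "\<dots> = integral\<^sup>L (lborel \<Otimes>\<^sub>M lborel) (\<lambda>(s, r). f s * (indicator {..s} r * g r)) +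
      integral\<^sup>L (lborel \<Otimes>\<^sub>M lborel) (\<lambda>(s, r). g r * (indicator {..<r} s * f s))"
    using i1 i2 by (rule Bochner_Integration.integral_add)
  also have "\<dots> = (\<integral>s. (\<integral>r. f s * (indicator {..s} r * g r) \<partial>lborel) \<partial>lborel) +
      (\<integral>r. (\<integral>s. g r * (indicator {..<r} s * f s) \<partial>lborel) \<partial>lborel)"
    using lborel_pair.integral_fst'[OF i1] lborel_pair.integral_snd[OF i2] by simp
  finally show ?thesis unfolding inner by (simp only: integral_mult_right_zero)
qed

text \<open>The product rule for densities that are merely integrable. Writing \<open>u\<close> and
  \<open>v\<close> inside the integrals as initial value plus integral turns the two terms into
  iterated integrals over the two triangles, which add up to a product.\<close>

lemma abs_cont_on_mult:
  assumes u: "abs_cont_on T u f" and v: "abs_cont_on T v g"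
  shows "abs_cont_on T (\<lambda>t. u t * v t) (\<lambda>t. v t * f t + u t * g t)"
proof (rule abs_cont_onI)
  have i: "set_integrable lborel {0..t} (\<lambda>t. v t * f t)" "set_integrable lborel {0..t} (\<lambda>t. u t * g t)"
    if "t \<le> T" for t
    using that by (auto intro!: set_integrable_mult_continuous abs_cont_on_integrable[OF u]
      abs_cont_on_integrable[OF v] continuous_on_subset[OF abs_cont_on_continuous[OF u]]
      continuous_on_subset[OF abs_cont_on_continuous[OF v]])
  then show "set_integrable lborel {0..T} (\<lambda>t. v t * f t + u t * g t)"
    by simp
  fix t assume t: "0 \<le> t" "t \<le> T"
  define f' g' where "f' s = indicator {0..t} s * f s" and "g' s = indicator {0..t} s * g s" for s
  have fg: "integrable lborel f'" "integrable lborel g'"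
    using abs_cont_on_integrable[OF u t(2)] abs_cont_on_integrable[OF v t(2)]
    by (simp_all add: f'_def[abs_def] g'_def[abs_def] set_integrable_def)
  have U: "u s = u 0 + (\<integral>r. indicator {..s} r * f' r \<partial>lborel)"
    and V: "v s = v 0 + (\<integral>r. indicator {..s} r * g' r \<partial>lborel)" if "s \<in> {0..t}" for s
    using abs_cont_onD[OF u, of s] abs_cont_onD[OF v, of s] that t
    by (auto simp: set_lebesgue_integral_def f'_def g'_def indicator_def
      intro!: Bochner_Integration.integral_cong)
  have Ut: "u t = u 0 + integral\<^sup>L lborel f'" and Vt: "v t = v 0 + integral\<^sup>L lborel g'"
    using abs_cont_onD[OF u, of t] abs_cont_onD[OF v, of t] t
    by (auto simp: set_lebesgue_integral_def f'_def[abs_def] g'_def[abs_def])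
  \<comment> \<open>Stated for arbitrary functions because it is applied twice, with the roles of
    \<open>u\<close> and \<open>v\<close> exchanged.\<close>
  have "(LINT s:{0..t}|lborel. v s * f s) = v 0 * integral\<^sup>L lborel f' +
      (\<integral>s. f' s * (\<integral>r. indicator {..s} r * g' r \<partial>lborel) \<partial>lborel)"
    if "\<And>s. s \<in> {0..t} \<Longrightarrow> v s = v 0 + (\<integral>r. indicator {..s} r * g' r \<partial>lborel)"
      "set_integrable lborel {0..t} (\<lambda>t. v t * f t)" "integrable lborel f'"
      "\<And>s. f' s = indicator {0..t} s * f s"
    for v f f' g' :: "real \<Rightarrow> real"
  proof -
    have "(\<integral>s. f' s * (\<integral>r. indicator {..s} r * g' r \<partial>lborel) \<partial>lborel) =
        (\<integral>s. (indicator {0..t} s *\<^sub>R (v s * f s) - v 0 * f' s) \<partial>lborel)"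
    proof (intro Bochner_Integration.integral_cong refl)
      fix s
      show "f' s * (\<integral>r. indicator {..s} r * g' r \<partial>lborel) = indicator {0..t} s *\<^sub>R (v s * f s) - v 0 * f' s"
        using that(1)[of s] that(4)[of s] by (cases "s \<in> {0..t}") (auto simp: algebra_simps)
    qed
    also have "\<dots> = (LINT s:{0..t}|lborel. v s * f s) - v 0 * integral\<^sup>L lborel f'"
      using that(2,3) by (simp add: set_integrable_def set_lebesgue_integral_def)
    finally show ?thesis by simp
  qed
  note P = this
  have "(LINT s:{0..t}|lborel. v s * f s) + (LINT s:{0..t}|lborel. u s * g s) =
      v 0 * integral\<^sup>L lborel f' + u 0 * integral\<^sup>L lborel g' + integral\<^sup>L lborel f' * integral\<^sup>L lborel g'"
    using P[OF V i(1) fg(1), OF _ t(2)] P[OF U i(2) fg(2), OF _ t(2)] integral_product_triangles[OF fg]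
    by (simp add: f'_def g'_def)
  then show "u t * v t = u 0 * v 0 + (LINT s:{0..t}|lborel. v s * f s + u s * g s)"
    using i[OF t(2)] by (simp add: Ut Vt algebra_simps)
qed

lemma set_integral_mono_AE_lborel:
  fixes f g :: "real \<Rightarrow> real"
  assumes "set_integrable lborel A f" "set_integrable lborel A g"
    and "AE s in lborel. s \<in> A \<longrightarrow> f s \<le> g s"
  shows "(LINT s:A|lborel. f s) \<le> (LINT s:A|lborel. g s)"
  using assms unfolding set_lebesgue_integral_def set_integrable_def
  by (intro integral_mono_AE) (auto simp: indicator_def elim!: eventually_mono)

lemma abs_cont_on_bound:
  assumes u: "abs_cont_on T u f" and h: "set_integrable lborel {0..T} h"
    and le: "AE s in lborel. s \<in> {0..T} \<longrightarrow> \<bar>f s\<bar> \<le> h s" and t: "0 \<le> t" "t \<le> T"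
  shows "\<bar>u t - u 0\<bar> \<le> (LINT s:{0..t}|lborel. h s)"
proof -
  have f: "set_integrable lborel {0..t} f" and h: "set_integrable lborel {0..t} h"
    using abs_cont_on_integrable[OF u t(2)] h t by (auto intro: set_integrable_subset)
  have "\<bar>LINT s:{0..t}|lborel. f s\<bar> \<le> (LINT s:{0..t}|lborel. \<bar>f s\<bar>)"
    using set_integral_norm_bound[OF f] by simp
  also have "\<dots> \<le> (LINT s:{0..t}|lborel. h s)"
    using set_integrable_abs[OF f] h le t
    by (intro set_integral_mono_AE_lborel) (auto elim!: eventually_mono)
  finally show ?thesis using abs_cont_onD[OF u t] by simp
qed

section \<open>Ordered roots and the convolution with the Hermite zeros\<close>

text \<open>The polynomials with these roots coincide, hence so do the multisets of roots, and a
  sorted list is determined by its multiset.\<close>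

lemma mono_on_eq_if_esym_eq:
  fixes x y :: "nat \<Rightarrow> real"
  assumes "mono_on {1..N} x" "mono_on {1..N} y"
    and esym: "\<And>k. k \<in> {1..N} \<Longrightarrow> esym {1..N} k x = esym {1..N} k y" and "i \<in> {1..N}"
  shows "x i = y i"
proof -
  have proots: "proots (\<Prod>i\<in>{1..N}. [:- x i, 1:]) = mset (map x [1..<Suc N])" for x :: "nat \<Rightarrow> real"
  proof -
    have "proots (\<Prod>i\<in>{1..N}. [:- x i, 1:]) = (\<Sum>i\<in>{1..N}. {#x i#})"
      by (subst proots_prod) auto
    also have "\<dots> = (\<Sum>i\<leftarrow>[1..<Suc N]. {#x i#})"
      by (simp only: sum_list_distinct_conv_sum_set[OF distinct_upt] set_upt atLeastLessThanSuc_atLeastAtMost)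
    also have "\<dots> = mset (map x [1..<Suc N])"
      by (induction N) auto
    finally show ?thesis .
  qed
  have sorted: "sorted (map x [1..<Suc N])" if "mono_on {1..N} x" for x :: "nat \<Rightarrow> real"
    using that by (auto simp: sorted_iff_nth_mono mono_on_def simp del: upt_Suc)
  have "esym {1..N} k x = esym {1..N} k y" if "k \<le> N" for k
    using esym[of k] that by (cases "k = 0") auto
  then have "(\<Prod>i\<in>{1..N}. [:- x i, 1:]) = (\<Prod>i\<in>{1..N}. [:- y i, 1:])"
    by (simp add: prod_linear_poly)
  then have "mset (map x [1..<Suc N]) = mset (map y [1..<Suc N])"
    by (simp only: proots[symmetric])
  then have "map x [1..<Suc N] = map y [1..<Suc N]"
    using sorted assms(1,2) by (metis properties_for_sort)
  then show ?thesis
    using assms(4) by (simp add: map_eq_conv del: upt_Suc)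
qed

section \<open>Continuity of ordered roots in the elementary symmetric polynomials\<close>

lemma tendsto_esym:
  assumes "finite A" "\<And>i. i \<in> A \<Longrightarrow> (\<lambda>n. X n i) \<longlonglongrightarrow> l i"
  shows "(\<lambda>n. esym A k (X n)) \<longlonglongrightarrow> esym A k l"
  unfolding esym_def using assms by (intro tendsto_sum tendsto_prod) auto

lemma bounded_tuples_subseq:
  fixes X :: "nat \<Rightarrow> nat \<Rightarrow> real"
  assumes "finite A" "\<And>n i. i \<in> A \<Longrightarrow> \<bar>X n i\<bar> \<le> R"
  shows "\<exists>l r. strict_mono (r :: nat \<Rightarrow> nat) \<and> (\<forall>i\<in>A. (\<lambda>n. X (r n) i) \<longlonglongrightarrow> l i)"
proof -
  have "\<forall>d\<subseteq>A. \<exists>l r. strict_mono (r :: nat \<Rightarrow> nat) \<and>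
    (\<forall>e>0. eventually (\<lambda>n. \<forall>i\<in>d. dist (X (r n) i) (l i) < e) sequentially)"
    by (rule compact_lemma_general[where unproj = "\<lambda>x. x"])
      (use assms in \<open>auto simp: bounded_iff\<close>)
  then obtain l r where "strict_mono (r :: nat \<Rightarrow> nat)"
    and "\<forall>e>0. eventually (\<lambda>n. \<forall>i\<in>A. dist (X (r n) i) (l i) < e) sequentially"
    by blast
  then show ?thesis
    by (intro exI[of _ l] exI[of _ r]) (auto simp: tendsto_iff elim!: eventually_mono)
qed

text \<open>On bounded ordered tuples the map to the elementary symmetric polynomials is continuous
  and injective, so by compactness its inverse is uniformly continuous. Counterexamples for
  \<open>\<rho> = 1 / (n + 1)\<close> would have limits with equal polynomials, hence equal limits,
  against the distance \<open>\<eta>\<close>.\<close>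

lemma sorted_tuples_close_if_esym_close:
  fixes \<eta> R :: real
  assumes "\<eta> > 0"
  obtains \<rho> where "\<rho> > 0"
    "\<And>x y i. mono_on {1..N} x \<Longrightarrow> mono_on {1..N} y \<Longrightarrow>
      (\<And>i. i \<in> {1..N} \<Longrightarrow> \<bar>x i\<bar> \<le> R) \<Longrightarrow> (\<And>i. i \<in> {1..N} \<Longrightarrow> \<bar>y i\<bar> \<le> R) \<Longrightarrow>
      (\<And>k. k \<in> {1..N} \<Longrightarrow> \<bar>esym {1..N} k x - esym {1..N} k y\<bar> \<le> \<rho>) \<Longrightarrow> i \<in> {1..N} \<Longrightarrow>
      \<bar>x i - y i\<bar> \<le> \<eta>"
proof (rule ccontr)
  let ?P = "\<lambda>\<rho> x y. mono_on {1..N} x \<and> mono_on {1..N} y \<and> (\<forall>i\<in>{1..N}. \<bar>x i\<bar> \<le> R \<and> \<bar>y i\<bar> \<le> R) \<and>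
    (\<forall>k\<in>{1..N}. \<bar>esym {1..N} k x - esym {1..N} k y\<bar> \<le> \<rho>) \<and> (\<exists>i\<in>{1..N}. \<bar>x i - y i\<bar> > \<eta>)"
  note conclude = that
  assume contr: "\<not> thesis"
  have "\<exists>x y. ?P \<rho> x y" if "\<rho> > 0" for \<rho>
  proof (rule ccontr)
    assume "\<nexists>x y. ?P \<rho> x y"
    then have *: "\<forall>x y i. mono_on {1..N} x \<longrightarrow> mono_on {1..N} y \<longrightarrow>
      (\<forall>i\<in>{1..N}. \<bar>x i\<bar> \<le> R) \<longrightarrow> (\<forall>i\<in>{1..N}. \<bar>y i\<bar> \<le> R) \<longrightarrow>
      (\<forall>k\<in>{1..N}. \<bar>esym {1..N} k x - esym {1..N} k y\<bar> \<le> \<rho>) \<longrightarrow> i \<in> {1..N} \<longrightarrow>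
      \<bar>x i - y i\<bar> \<le> \<eta>"
      by (meson not_le)
    have thesis by (rule conclude[OF \<open>\<rho> > 0\<close>]) (use * in blast)
    then show False using contr by contradiction
  qed
  then have "\<forall>n. \<exists>x y. ?P (1 / real (Suc n)) x y"
    by simp
  then obtain X Y where XY: "\<And>n. ?P (1 / real (Suc n)) (X n) (Y n)"
    by metis
  have bX: "\<And>n i. i \<in> {1..N} \<Longrightarrow> \<bar>X n i\<bar> \<le> R" and bY: "\<And>n i. i \<in> {1..N} \<Longrightarrow> \<bar>Y n i\<bar> \<le> R"
    using XY by blast+
  obtain l r where r: "strict_mono r" and l: "\<And>i. i \<in> {1..N} \<Longrightarrow> (\<lambda>n. X (r n) i) \<longlonglongrightarrow> l i"
    using bounded_tuples_subseq[of "{1..N}" X R, OF finite_atLeastAtMost bX] by blast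
  \<comment> \<open>Extracted from the first subsequence, so that both sequences converge along
    \<open>q\<close>.\<close>
  obtain l' r' where r': "strict_mono r'" and l': "\<And>i. i \<in> {1..N} \<Longrightarrow> (\<lambda>n. Y (r (r' n)) i) \<longlonglongrightarrow> l' i"
    using bounded_tuples_subseq[of "{1..N}" "\<lambda>n. Y (r n)" R, OF finite_atLeastAtMost bY] by blast
  define q where "q n = r (r' n)" for n
  have q: "strict_mono q"
    using r r' by (simp add: q_def strict_mono_def)
  have X: "(\<lambda>n. X (q n) i) \<longlonglongrightarrow> l i" and Y: "(\<lambda>n. Y (q n) i) \<longlonglongrightarrow> l' i" if "i \<in> {1..N}" for i
    using LIMSEQ_subseq_LIMSEQ[OF l[OF that] r'] l'[OF that] by (simp_all add: q_def o_def)
  have mono: "mono_on {1..N} l" if "\<And>n. mono_on {1..N} (X n)" "\<And>i. i \<in> {1..N} \<Longrightarrow> (\<lambda>n. X n i) \<longlonglongrightarrow> l i"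
    for X :: "nat \<Rightarrow> nat \<Rightarrow> real" and l
  proof (rule mono_onI)
    fix i j assume ij: "i \<in> {1..N}" "j \<in> {1..N}" "i \<le> j"
    have "X n i \<le> X n j" for n
      using that(1) ij by (rule mono_onD)
    then show "l i \<le> l j"
      using LIMSEQ_le[OF that(2)[OF ij(1)] that(2)[OF ij(2)]] by blast
  qed
  have "mono_on {1..N} l"
    using mono[of "\<lambda>n. X (q n)", OF _ X] XY by blast
  moreover have "mono_on {1..N} l'"
    using mono[of "\<lambda>n. Y (q n)", OF _ Y] XY by blast
  moreover have "esym {1..N} k l = esym {1..N} k l'" if k: "k \<in> {1..N}" for k
  proof -
    have "(\<lambda>n. esym {1..N} k (X (q n)) - esym {1..N} k (Y (q n))) \<longlonglongrightarrow> esym {1..N} k l - esym {1..N} k l'"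
      using X Y by (intro tendsto_diff tendsto_esym) auto
    moreover have "(\<lambda>n. esym {1..N} k (X (q n)) - esym {1..N} k (Y (q n))) \<longlonglongrightarrow> 0"
    proof (rule tendsto_rabs_zero_cancel, rule tendsto_sandwich[OF _ _ tendsto_const])
      show "\<forall>\<^sub>F n in sequentially. 0 \<le> \<bar>esym {1..N} k (X (q n)) - esym {1..N} k (Y (q n))\<bar>"
        by simp
      show "\<forall>\<^sub>F n in sequentially. \<bar>esym {1..N} k (X (q n)) - esym {1..N} k (Y (q n))\<bar> \<le> 1 / real (Suc (q n))"
        using XY k by (intro always_eventually) blast
      show "(\<lambda>n. 1 / real (Suc (q n))) \<longlonglongrightarrow> 0"
        using LIMSEQ_subseq_LIMSEQ[OF LIMSEQ_Suc[OF lim_inverse_n'] q] by (simp add: o_def)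
    qed
    ultimately show ?thesis using LIMSEQ_unique by fastforce
  qed
  ultimately have eq: "l i = l' i" if "i \<in> {1..N}" for i
    using that by (rule mono_on_eq_if_esym_eq)
  have "eventually (\<lambda>n. \<forall>i\<in>{1..N}. \<bar>X (q n) i - Y (q n) i\<bar> < \<eta>) sequentially"
  proof (intro eventually_ball_finite ballI)
    fix i assume i: "i \<in> {1..N}"
    have "(\<lambda>n. \<bar>X (q n) i - Y (q n) i\<bar>) \<longlonglongrightarrow> 0"
      using tendsto_rabs[OF tendsto_diff[OF X[OF i] Y[OF i]]] eq[OF i] by simp
    then show "eventually (\<lambda>n. \<bar>X (q n) i - Y (q n) i\<bar> < \<eta>) sequentially"
      using assms by (rule order_tendstoD)
  qed simp
  then obtain n where "\<forall>i\<in>{1..N}. \<bar>X (q n) i - Y (q n) i\<bar> < \<eta>"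
    using eventually_happens by fastforce
  then show False using XY[of "q n"] by fastforce
qed

section \<open>The convolution with the Hermite zeros as a function of time\<close>

lemma abs_cont_on_if_has_real_derivative:
  assumes "\<And>t. (u has_real_derivative f t) (at t)" "\<And>t. isCont f t"
  shows "abs_cont_on T u f"
proof (rule abs_cont_onI)
  show "set_integrable lborel {0..T} f"
    using assms(2) by (intro borel_integrable_atLeastAtMost') (auto intro: continuous_at_imp_continuous_on)
  fix t :: real assume "0 \<le> t"
  have "(LINT s:{0..t}|lborel. f s) = u t - u 0"
    using integral_FTC_Icc_real[OF \<open>0 \<le> t\<close>, of u f] assms
    by (simp add: set_lebesgue_integral_def mult.commute)
  then show "u t = u 0 + (LINT s:{0..t}|lborel. f s)" by simp
qed

lemma abs_cont_on_cong:
  assumes "abs_cont_on T v g" "\<And>t. t \<in> {0..T} \<Longrightarrow> u t = v t" "\<And>t. t \<in> {0..T} \<Longrightarrow> f t = g t"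
  shows "abs_cont_on T u f"
proof (rule abs_cont_onI)
  show "set_integrable lborel {0..T} f"
    using abs_cont_on_integrable[OF assms(1) order_refl]
      set_integrable_cong[of lborel lborel "{0..T}" "{0..T}" f g] assms(3) by blast
  fix t assume t: "0 \<le> t" "t \<le> T"
  have u: "u t = v t" "u 0 = v 0"
    using assms(2) t by auto
  have "(LINT s:{0..t}|lborel. f s) = (LINT s:{0..t}|lborel. g s)"
    using assms(3) t by (intro set_lebesgue_integral_cong) auto
  then show "u t = u 0 + (LINT s:{0..t}|lborel. f s)"
    using abs_cont_onD[OF assms(1) t] by (simp only: u)
qed

lemma sum_antidiagonal: "(\<Sum>(i, j) | i + j = k. f i j) = (\<Sum>j\<le>k. f (k - j) (j :: nat))"
  by (rule sum.reindex_bij_witness[of _ "\<lambda>j. (k - j, j)" snd]) auto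

text \<open>Since the odd e_j of the zeros vanish, \<open>sqrt t\<close> enters only with even
  powers, and each e_k of \<open>y t\<close> is a polynomial in t. The system can therefore be
  checked coefficient by coefficient.\<close>

lemma esym_hermite_conv:
  fixes a z :: "nat \<Rightarrow> real" and y :: "real \<Rightarrow> nat \<Rightarrow> real"
  assumes N: "N \<ge> 2" and z: "inj_on z {1..N}" "z ` {1..N} = {x. poly (hermite_prob N) x = 0}"
    and y: "\<And>t. t \<ge> 0 \<Longrightarrow> is_finite_free_conv N a (\<lambda>k. sqrt t * z k) (y t)"
  shows esym_hermite_conv_1: "t \<ge> 0 \<Longrightarrow> esym {1..N} 1 (y t) = esym {1..N} 1 a"
    and esym_hermite_conv_start: "k \<le> N \<Longrightarrow> esym {1..N} k (y 0) = esym {1..N} k a"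
    and abs_cont_on_esym_hermite_conv: "k + 2 \<le> N \<Longrightarrow>
      abs_cont_on T (\<lambda>t. esym {1..N} (k + 2) (y t))
        (\<lambda>t. - ((real N - real k) * (real N - real k - 1) / 2) * esym {1..N} k (y t))"
proof -
  define h where "h j = esym {1..N} j z" for j
  define C where "C k j = fact (N - (k - j)) * fact (N - j) / (fact N * fact (N - k)) *
    esym {1..N} (k - j) a * h j" for k j
  define P where "P k t = (\<Sum>j\<le>k. C k j * t ^ (j div 2))" for k t
  have h0: "h 0 = 1" and h1: "h 1 = 0" and
    hrec: "j + 2 \<le> N \<Longrightarrow> real (j + 2) * h (j + 2) = - ((real N - real j) * (real N - real j - 1)) * h j" for j
    using esym_hermite_zeros[of z "{1..N}"] z N by (simp_all add: h_def)
  have hodd: "h (2 * m + 1) = 0" if "2 * m + 1 \<le> N" for m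
    using that
  proof (induction m)
    case 0
    then show ?case using h1 by simp
  next
    case (Suc m)
    then show ?case using hrec[of "2 * m + 1"] by simp
  qed
  have hodd': "h j = 0" if "odd j" "j \<le> N" for j
    using that hodd by (metis oddE)
  \<comment> \<open>For odd \<open>j\<close> the rounding in \<open>j div 2\<close> does no harm,
    since \<open>h j\<close> is 0.\<close>
  have pow: "sqrt t ^ j * h j = t ^ (j div 2) * h j" if "t \<ge> 0" "j \<le> N" for t j
  proof (cases "even j")
    case True
    then obtain m where "j = 2 * m" by blast
    then show ?thesis using that by (simp add: power_mult)
  next
    case False
    then show ?thesis using hodd' that by simp
  qed
  have yP: "esym {1..N} k (y t) = P k t" if "t \<ge> 0" "k \<le> N" for k t
  proof (cases "k = 0")
    case True
    then show ?thesis using h0 by (simp add: P_def C_def)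
  next
    case False
    then have "esym {1..N} k (y t) =
        (\<Sum>j\<le>k. fact (N - (k - j)) * fact (N - j) / (fact N * fact (N - k)) *
          esym {1..N} (k - j) a * (sqrt t ^ j * h j))"
      using y[OF that(1)] that
      by (simp add: is_finite_free_conv_def elem_sym_eq_esym sum_antidiagonal esym_cmult h_def)
    also have "\<dots> = P k t"
      unfolding P_def C_def using that by (intro sum.cong refl) (simp add: pow)
    finally show ?thesis .
  qed
  have C0: "C k 0 = esym {1..N} k a" if "k \<le> N" for k
    using h0 by (simp add: C_def)
  have P0: "P k 0 = C k 0" if "k \<le> N" for k
  proof -
    have "P k 0 = (\<Sum>j\<le>k. if j = 0 then C k 0 else 0)"
      unfolding P_def
    proof (intro sum.cong refl)
      fix j assume "j \<in> {..k}"
      then show "C k j * 0 ^ (j div 2) = (if j = 0 then C k 0 else 0)"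
        using h1 by (cases "j = 1") (auto simp: C_def power_0_left)
    qed
    then show ?thesis by simp
  qed
  show "esym {1..N} 1 (y t) = esym {1..N} 1 a" if "t \<ge> 0"
    using yP[OF that, of 1] N C0[of 1] h1 by (simp add: P_def C_def)
  show "esym {1..N} k (y 0) = esym {1..N} k a" if "k \<le> N"
    using yP[of 0 k] P0 C0 that by simp
  show "abs_cont_on T (\<lambda>t. esym {1..N} (k + 2) (y t))
        (\<lambda>t. - ((real N - real k) * (real N - real k - 1) / 2) * esym {1..N} k (y t))"
    if k: "k + 2 \<le> N"
  proof -
    let ?c = "(real N - real k) * (real N - real k - 1) / 2"
    \<comment> \<open>The factor from the Hermite recursion extends
      \<open>fact (N - (i + 2))\<close> to \<open>fact (N - i)\<close>, and passing from
      \<open>fact (N - (k + 2))\<close> to \<open>fact (N - k)\<close> produces \<open>?c\<close>.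
      For odd \<open>i\<close> both sides are 0.\<close>
    have Crec: "C (k + 2) (i + 2) * real (i div 2 + 1) = - ?c * C k i" if i: "i \<le> k" for i
    proof (cases "even i")
      case False
      then show ?thesis using hodd'[of i] hodd'[of "i + 2"] i k by (simp add: C_def)
    next
      case True
      have f: "fact (N - m) = (real N - real m) * (real N - real m - 1) * (fact (N - (m + 2)) :: real)"
        if "m + 2 \<le> N" for m
      proof -
        define d where "d = N - (m + 2)"
        have e: "N - m = Suc (Suc d)" "N - (m + 2) = d" "real N - real m = real d + 2"
          using that by (auto simp: d_def of_nat_diff)
        show ?thesis unfolding e by (simp add: algebra_simps)
      qed
      have half: "real (i div 2 + 1) = real (i + 2) / 2"
        using True by auto
      then have hi: "h (i + 2) * real (i div 2 + 1) = - ((real N - real i) * (real N - real i - 1)) * h i / 2"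
        using hrec[of i] i k unfolding half by (simp add: mult.commute)
      have fi: "fact (N - i) = (real N - real i) * (real N - real i - 1) * (fact (N - (i + 2)) :: real)"
        using i k by (intro f) simp
      have fk: "?c / fact (N - k) = 1 / (2 * fact (N - (k + 2)))"
      proof -
        have "(real N - real k) * (real N - real k - 1) \<noteq> 0" using k by simp
        then show ?thesis using f[OF k] by (simp add: field_simps)
      qed
      have "C (k + 2) (i + 2) * real (i div 2 + 1) =
          fact (N - (k - i)) * fact (N - (i + 2)) / (fact N * fact (N - (k + 2))) *
            esym {1..N} (k - i) a * (h (i + 2) * real (i div 2 + 1))"
        by (simp add: C_def)
      also have "\<dots> = - (1 / (2 * fact (N - (k + 2)))) * (fact (N - (k - i)) / fact N * esym {1..N} (k - i) a * h i *
           ((real N - real i) * (real N - real i - 1) * fact (N - (i + 2))))"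
        unfolding hi by (simp add: field_simps)
      also have "\<dots> = - ?c * C k i"
        unfolding fk[symmetric] fi[symmetric] C_def by (simp add: field_simps)
      finally show ?thesis .
    qed
    \<comment> \<open>It is \<open>P\<close> that is differentiated: it is a polynomial on the whole
      line, while \<open>y t\<close> is specified for \<open>t \<ge> 0\<close> only.\<close>
    have deriv: "(P (k + 2) has_real_derivative - ?c * P k t) (at t)" for t
    proof -
      have "(P (k + 2) has_real_derivative (\<Sum>j\<le>k + 2. C (k + 2) j * (real (j div 2) * t ^ (j div 2 - 1)))) (at t)"
        unfolding P_def[abs_def] using DERIV_pow by (intro DERIV_sum DERIV_cmult) simp
      also have "(\<Sum>j\<le>k + 2. C (k + 2) j * (real (j div 2) * t ^ (j div 2 - 1))) =
          (\<Sum>i\<le>k. C (k + 2) (i + 2) * real (i div 2 + 1) * t ^ (i div 2))"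
      proof -
        \<comment> \<open>The terms 0 and 1 are split off; both have \<open>j div 2 = 0\<close>, so
          their derivatives vanish and the rest is shifted by two.\<close>
        have *: "(\<Sum>j\<le>k + 2. F j) = F 0 + (F 1 + (\<Sum>i\<le>k. F (i + 2)))" for F :: "nat \<Rightarrow> real"
          by (simp add: sum.atMost_Suc_shift del: sum.atMost_Suc)
        show ?thesis by (subst *) (simp add: mult.assoc)
      qed
      also have "\<dots> = - ?c * P k t"
        unfolding P_def sum_distrib_left using Crec by (intro sum.cong) (auto simp: mult.assoc)
      finally show ?thesis .
    qed
    have "isCont (\<lambda>t. - ?c * P k t) t" for t
      unfolding P_def by (intro continuous_intros)
    then have "abs_cont_on T (P (k + 2)) (\<lambda>t. - ?c * P k t)"
      using deriv by (intro abs_cont_on_if_has_real_derivative)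
    then show ?thesis
      using yP k by (rule_tac abs_cont_on_cong) auto
  qed
qed

section \<open>Paths with small noise\<close>

text \<open>The derivative in \<open>x i\<close> is e_k of the other variables. Adding one variable
  at a time reduces the chain rule to the product rule.\<close>

lemma abs_cont_on_esym:
  assumes "finite A" "\<And>i. i \<in> A \<Longrightarrow> abs_cont_on T (u i) (f i)"
  shows "abs_cont_on T (\<lambda>t. esym A (Suc k) (\<lambda>i. u i t))
    (\<lambda>t. \<Sum>i\<in>A. esym (A - {i}) k (\<lambda>i. u i t) * f i t)"
  using assms
proof (induction A arbitrary: k rule: finite_induct)
  case empty
  then show ?case by (simp add: esym_eq_0 abs_cont_on_const)
next
  case (insert i A)
  have rem: "esym (insert i A - {j}) (Suc m) x = esym (A - {j}) (Suc m) x + x i * esym (A - {j}) m x"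
    if "j \<in> A" for j m x
  proof -
    have "insert i A - {j} = insert i (A - {j})" using that insert by auto
    then show ?thesis using that insert.hyps esym_insert[of "A - {j}" i m x] by simp
  qed
  have IH: "abs_cont_on T (\<lambda>t. esym A (Suc k) (\<lambda>i. u i t))
    (\<lambda>t. \<Sum>i\<in>A. esym (A - {i}) k (\<lambda>i. u i t) * f i t)" for k
    using insert.prems by (intro insert.IH) auto
  show ?case
  proof (cases k)
    case 0
    then show ?thesis
      using abs_cont_on_add[OF IH[of 0] insert.prems[of i]] insert.hyps
      by (simp add: esym_insert add.commute)
  next
    case (Suc m)
    have "(\<Sum>j\<in>insert i A. esym (insert i A - {j}) k (\<lambda>i. u i t) * f j t) =
        (\<Sum>j\<in>A. esym (A - {j}) k (\<lambda>i. u i t) * f j t) + (esym A k (\<lambda>i. u i t) * f i t +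
          u i t * (\<Sum>j\<in>A. esym (A - {j}) m (\<lambda>i. u i t) * f j t))" for t
      using insert.hyps by (simp add: Suc rem sum_distrib_left sum.distrib algebra_simps)
    then show ?thesis
      using abs_cont_on_add[OF IH[of k] abs_cont_on_mult[OF insert.prems[of i] IH[of m]]] insert.hyps
      by (simp add: esym_insert Suc add_ac)
  qed
qed

text \<open>Size and difference are estimated together because the difference after adding a
  variable involves the size. With \<open>?L\<close> the old constant, the size grows by the factor
  \<open>1 + B\<close> and the difference by \<open>2 + B\<close>; this is the origin of the
  base.\<close>

lemma esym_bound_lipschitz:
  fixes u x :: "nat \<Rightarrow> real"
  assumes "finite A" "B \<ge> 0" "d \<ge> 0"
    and "\<And>i. i \<in> A \<Longrightarrow> \<bar>u i\<bar> \<le> B" "\<And>i. i \<in> A \<Longrightarrow> \<bar>x i\<bar> \<le> B" "\<And>i. i \<in> A \<Longrightarrow> \<bar>u i - x i\<bar> \<le> d"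
  shows "\<bar>esym A k u\<bar> \<le> (2 + B) ^ card A \<and> \<bar>esym A k u - esym A k x\<bar> \<le> (2 + B) ^ card A * d"
  using assms(1,4,5,6)
proof (induction A arbitrary: k rule: finite_induct)
  case empty
  show ?case using \<open>d \<ge> 0\<close> by (cases k) (auto simp: esym_eq_0)
next
  case (insert i A)
  let ?L = "(2 + B) ^ card A"
  have L: "1 \<le> ?L" using \<open>B \<ge> 0\<close> by simp
  have IH: "\<bar>esym A k u\<bar> \<le> ?L" "\<bar>esym A k u - esym A k x\<bar> \<le> ?L * d" for k
    using insert.IH[of k] insert.prems by auto
  show ?case
  proof (cases k)
    case 0
    have "1 \<le> (2 + B) ^ card (insert i A)" using \<open>B \<ge> 0\<close> by (intro one_le_power) simp
    then show ?thesis using 0 insert.hyps \<open>d \<ge> 0\<close> by simp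
  next
    case (Suc m)
    have "\<bar>u i * esym A m u\<bar> \<le> B * ?L"
      unfolding abs_mult using IH insert.prems \<open>B \<ge> 0\<close> by (intro mult_mono) auto
    then have 1: "\<bar>esym (insert i A) k u\<bar> \<le> ?L + B * ?L"
      using IH(1)[of "Suc m"] insert.hyps by (simp add: Suc esym_insert)
    have "\<bar>(u i - x i) * esym A m u\<bar> \<le> d * ?L"
      unfolding abs_mult using IH insert.prems \<open>d \<ge> 0\<close> by (intro mult_mono) auto
    moreover have "\<bar>x i * (esym A m u - esym A m x)\<bar> \<le> B * (?L * d)"
      unfolding abs_mult using IH insert.prems \<open>B \<ge> 0\<close> by (intro mult_mono) auto
    moreover have "esym (insert i A) k u - esym (insert i A) k x =
        (esym A k u - esym A k x) + (u i - x i) * esym A m u + x i * (esym A m u - esym A m x)"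
      using insert.hyps by (simp add: Suc esym_insert algebra_simps)
    ultimately have "\<bar>esym (insert i A) k u - esym (insert i A) k x\<bar> \<le> ?L * d + d * ?L + B * (?L * d)"
      using IH(2)[of k] by linarith
    then show ?thesis using 1 L insert.hyps by (simp add: algebra_simps)
  qed
qed

lemma abs_le_one_plus_square: "\<bar>r\<bar> \<le> 1 + r\<^sup>2" for r :: real
  using zero_le_power2[of "\<bar>r\<bar> - 1"] zero_le_power2[of r] by (simp add: power2_diff)

text \<open>
  \<open>u\<close> is the path \<open>x\<close> with the noise subtracted, \<open>d\<close> bounds the noise, and \<open>m\<close> is the
  limit of the elementary symmetric polynomials of \<open>x\<close> as \<open>d\<close> tends to \<open>0\<close>.
\<close>

locale dyson_path =
  fixes N :: nat and T d :: real and a :: "nat \<Rightarrow> real" and x u m :: "nat \<Rightarrow> real \<Rightarrow> real"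
  assumes T: "T \<ge> 0" and d0: "d \<ge> 0" and d1: "8 * real N * d \<le> 1" and N: "N \<ge> 1"
    and mono: "\<And>s. s \<in> {0..T} \<Longrightarrow> mono_on {1..N} (\<lambda>i. x i s)"
    and distinct: "AE s in lborel. s \<in> {0..T} \<longrightarrow> inj_on (\<lambda>i. x i s) {1..N}"
    and integrable: "\<And>i j. i \<in> {1..N} \<Longrightarrow> j \<in> {1..N} - {i} \<Longrightarrow>
      set_integrable lborel {0..T} (\<lambda>s. 1 / (x i s - x j s))"
    and u: "\<And>i. i \<in> {1..N} \<Longrightarrow> abs_cont_on T (u i) (\<lambda>s. \<Sum>j\<in>{1..N} - {i}. 1 / (x i s - x j s))"
    and u0: "\<And>i. i \<in> {1..N} \<Longrightarrow> u i 0 = a i"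
    and close: "\<And>i s. i \<in> {1..N} \<Longrightarrow> s \<in> {0..T} \<Longrightarrow> \<bar>u i s - x i s\<bar> \<le> d"
    and m_0: "\<And>t. t \<in> {0..T} \<Longrightarrow> m 0 t = 1"
    and m_1: "\<And>t. t \<in> {0..T} \<Longrightarrow> m 1 t = esym {1..N} 1 a"
    and m_start: "\<And>k. k \<le> N \<Longrightarrow> m k 0 = esym {1..N} k a"
    and m_rec: "\<And>k. k + 2 \<le> N \<Longrightarrow>
      abs_cont_on T (m (k + 2)) (\<lambda>t. - ((real N - real k) * (real N - real k - 1) / 2) * m k t)"
begin

section \<open>Bounds uniform in the noise\<close>

definition "drift i s = (\<Sum>j\<in>{1..N} - {i}. 1 / (x i s - x j s))"
definition "gap s = (\<Sum>i\<in>{1..N}. \<Sum>j\<in>{1..N} - {i}. \<bar>1 / (x i s - x j s)\<bar>)"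
definition "A2 = (\<Sum>i\<in>{1..N}. (a i)\<^sup>2)"
text \<open>These constants depend on \<open>N\<close>, \<open>T\<close> and \<open>a\<close> only,
  not on the path or on \<open>d\<close>. \<open>K\<close> bounds the sum of the
  \<open>(u i t)\<^sup>2\<close>, \<open>\<Gamma>\<close> the time integral of \<open>gap\<close>;
  \<open>L\<close> is a Lipschitz constant for entries bounded by \<open>2 + K\<close>;
  \<open>V\<close> is the factor on the error passed from level k to level k + 2, and
  \<open>W * d\<close> the error newly made there.\<close>

definition "K = 3 * A2 + 2 * (real N)\<^sup>2 * T + 2 * real N"
definition "\<Gamma> = 2 * real N * (2 * real N + K + A2)"
definition "L = (4 + K) ^ N"
definition "V = (real N)\<^sup>2 * T"
definition "W = L * (\<Gamma> + V)"

lemma u_drift: "i \<in> {1..N} \<Longrightarrow> abs_cont_on T (u i) (drift i)"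
  using u by (simp add: drift_def[abs_def])

lemma A2_nonneg: "0 \<le> A2"
  unfolding A2_def by (intro sum_nonneg) simp

lemma K_nonneg: "0 \<le> K"
  unfolding K_def using A2_nonneg T by (intro add_nonneg_nonneg mult_nonneg_nonneg) auto

lemma \<Gamma>_nonneg: "0 \<le> \<Gamma>"
  unfolding \<Gamma>_def using A2_nonneg K_nonneg by (intro mult_nonneg_nonneg) auto

lemma L_nonneg: "0 \<le> L"
  unfolding L_def using K_nonneg by simp

lemma V_nonneg: "0 \<le> V"
  unfolding V_def using T by simp

lemma W_nonneg: "0 \<le> W"
  unfolding W_def using L_nonneg \<Gamma>_nonneg V_nonneg by simp

lemma gap_integrable: "set_integrable lborel {0..t} gap" if "t \<le> T"
proof -
  have "set_integrable lborel {0..T} gap"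
    unfolding gap_def[abs_def] set_integrable_def scaleR_sum_right
    using set_integrable_abs[OF integrable]
    by (intro Bochner_Integration.integrable_sum) (simp add: set_integrable_def)
  then show ?thesis by (rule set_integrable_subset) (use that in auto)
qed

lemma sum_drift_bound:
  assumes "\<And>i. i \<in> {1..N} \<Longrightarrow> \<bar>c i\<bar> \<le> e"
  shows "\<bar>\<Sum>i\<in>{1..N}. c i * drift i s\<bar> \<le> e * gap s"
proof -
  have "\<bar>\<Sum>i\<in>{1..N}. c i * drift i s\<bar> \<le> (\<Sum>i\<in>{1..N}. \<bar>c i\<bar> * \<bar>drift i s\<bar>)"
    by (rule order_trans[OF sum_abs]) (simp add: abs_mult)
  also have "\<dots> \<le> (\<Sum>i\<in>{1..N}. e * (\<Sum>j\<in>{1..N} - {i}. \<bar>1 / (x i s - x j s)\<bar>))"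
    unfolding drift_def using assms
    by (intro sum_mono mult_mono sum_abs) (auto intro: order_trans[OF abs_ge_zero])
  finally show ?thesis by (simp add: gap_def sum_distrib_left)
qed

lemma sum_drift_antisym:
  "(\<Sum>i\<in>{1..N}. f i * drift i s) =
    (\<Sum>i\<in>{1..N}. \<Sum>j\<in>{1..N} - {i}. (f i - f j) * (1 / (x i s - x j s))) / 2"
  unfolding drift_def by (intro sum_antisym) (auto simp: minus_divide_right)

text \<open>The weight \<open>i\<close> turns the drift into a sum of nonnegative terms which controls all inverse gaps.\<close>

lemma gap_le: "s \<in> {0..T} \<Longrightarrow> gap s \<le> 2 * (\<Sum>i\<in>{1..N}. real i * drift i s)"
proof -
  assume s: "s \<in> {0..T}"
  have "\<bar>1 / (x i s - x j s)\<bar> \<le> (real i - real j) * (1 / (x i s - x j s))"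
    if ij: "i \<in> {1..N}" "j \<in> {1..N} - {i}" for i j
  proof -
    define r where "r = 1 / (x i s - x j s)"
    \<comment> \<open>The order of the entries fixes the sign of \<open>r\<close>, and distinct
      ranks differ by at least 1; at a collision \<open>r\<close> is 0 and both sides
      vanish.\<close>
    have "\<bar>r\<bar> \<le> (real i - real j) * r"
    proof (cases "i < j")
      case True
      then have "x i s \<le> x j s" using mono_onD[OF mono[OF s], of i j] ij by simp
      then have *: "r \<le> 0" by (simp add: r_def divide_nonneg_nonpos)
      have "(real j - real i - 1) * r \<le> 0"
        using True by (intro mult_nonneg_nonpos *) auto
      then show ?thesis using * by (simp add: algebra_simps)
    next
      case False
      then have "i > j" using ij by auto
      then have "x j s \<le> x i s" using mono_onD[OF mono[OF s], of j i] ij by simp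
      then have *: "r \<ge> 0" by (simp add: r_def)
      have "(real i - real j - 1) * r \<ge> 0"
        using \<open>i > j\<close> by (intro mult_nonneg_nonneg *) auto
      then show ?thesis using * by (simp add: algebra_simps)
    qed
    then show ?thesis by (simp only: r_def)
  qed
  then have "gap s \<le> (\<Sum>i\<in>{1..N}. \<Sum>j\<in>{1..N} - {i}. (real i - real j) * (1 / (x i s - x j s)))"
    unfolding gap_def by (intro sum_mono)
  then show ?thesis by (simp only: sum_drift_antisym)
qed

text \<open>Tested against \<open>x\<close> itself the singularity cancels: after symmetrization
  each ordered pair contributes 1, or 0 at a collision.\<close>

lemma sum_x_drift: "2 * (\<Sum>i\<in>{1..N}. x i s * drift i s) \<le> (real N)\<^sup>2"
proof -
  have "2 * (\<Sum>i\<in>{1..N}. x i s * drift i s) =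
      (\<Sum>i\<in>{1..N}. \<Sum>j\<in>{1..N} - {i}. (x i s - x j s) * (1 / (x i s - x j s)))"
    by (simp only: sum_drift_antisym)
  also have "\<dots> \<le> (\<Sum>i\<in>{1..N}. \<Sum>j\<in>{1..N}. 1)"
  proof (intro sum_mono)
    fix i
    have "(\<Sum>j\<in>{1..N} - {i}. (x i s - x j s) * (1 / (x i s - x j s))) \<le> (\<Sum>j\<in>{1..N} - {i}. 1)"
      by (intro sum_mono) auto
    also have "\<dots> \<le> (\<Sum>j\<in>{1..N}. 1 :: real)"
      by (intro sum_mono2) auto
    finally show "(\<Sum>j\<in>{1..N} - {i}. (x i s - x j s) * (1 / (x i s - x j s))) \<le> (\<Sum>j\<in>{1..N}. 1)" .
  qed
  finally show ?thesis by (simp add: power2_eq_square)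
qed

text \<open>The integrated rank-weighted drift is a combination of the displacements
  \<open>u i t - a i\<close>. These are replaced by squares because the sum of squares is the
  quantity that can be bounded independently.\<close>

lemma gap_integral_le:
  assumes t: "t \<in> {0..T}"
  shows "(LINT s:{0..t}|lborel. gap s) \<le> 2 * real N * (2 * real N + (\<Sum>i\<in>{1..N}. (u i t)\<^sup>2) + A2)"
proof -
  let ?v = "\<lambda>t. \<Sum>i\<in>{1..N}. 2 * real i * u i t"
  have v: "abs_cont_on T ?v (\<lambda>s. \<Sum>i\<in>{1..N}. 2 * real i * drift i s)"
    by (intro abs_cont_on_sum abs_cont_on_cmult u_drift)
  have "(LINT s:{0..t}|lborel. gap s) \<le> (LINT s:{0..t}|lborel. (\<Sum>i\<in>{1..N}. 2 * real i * drift i s))"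
    using gap_le t
    by (intro set_integral_mono_AE_lborel gap_integrable abs_cont_on_integrable[OF v] AE_I2)
      (auto simp: sum_distrib_left mult.assoc)
  also have "\<dots> = (\<Sum>i\<in>{1..N}. 2 * real i * (u i t - a i))"
    using abs_cont_onD[OF v, of t] t by (simp add: u0 sum_subtractf algebra_simps)
  also have "\<dots> \<le> (\<Sum>i\<in>{1..N}. 2 * real N * (2 + (u i t)\<^sup>2 + (a i)\<^sup>2))"
  proof (intro sum_mono)
    fix i assume i: "i \<in> {1..N}"
    note le = abs_le_one_plus_square
    have "2 * real i * (u i t - a i) \<le> 2 * real i * (\<bar>u i t\<bar> + \<bar>a i\<bar>)"
      by (intro mult_left_mono) auto
    also have "\<dots> \<le> 2 * real N * (2 + (u i t)\<^sup>2 + (a i)\<^sup>2)"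
      using i le[of "u i t"] le[of "a i"] by (intro mult_mono) auto
    finally show "2 * real i * (u i t - a i) \<le> 2 * real N * (2 + (u i t)\<^sup>2 + (a i)\<^sup>2)" .
  qed
  also have "\<dots> = 2 * real N * (2 * real N + (\<Sum>i\<in>{1..N}. (u i t)\<^sup>2) + A2)"
    by (simp add: A2_def sum_distrib_left[symmetric] sum.distrib)
  finally show ?thesis .
qed

text \<open>The density of the sum of squares is at most
  \<open>(real N)\<^sup>2 + 2 * d * gap s\<close>, and the integral of \<open>gap\<close> is itself
  bounded by the sum of squares at the same time \<open>t\<close>. Under
  \<open>8 * real N * d \<le> 1\<close> at most half of that sum reappears on the right; solving for
  it gives \<open>K\<close>.\<close>

lemma sum_u_sq_le:
  assumes t: "t \<in> {0..T}"
  shows "(\<Sum>i\<in>{1..N}. (u i t)\<^sup>2) \<le> K"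
proof -
  let ?Q = "\<lambda>t. \<Sum>i\<in>{1..N}. (u i t)\<^sup>2" and ?G = "LINT s:{0..t}|lborel. gap s"
  have Q: "abs_cont_on T ?Q (\<lambda>s. \<Sum>i\<in>{1..N}. 2 * u i s * drift i s)"
  proof (intro abs_cont_on_sum)
    fix i assume "i \<in> {1..N}"
    then show "abs_cont_on T (\<lambda>t. (u i t)\<^sup>2) (\<lambda>s. 2 * u i s * drift i s)"
      using abs_cont_on_mult[OF u_drift u_drift, of i i] by (simp add: power2_eq_square algebra_simps)
  qed
  have le: "(\<Sum>i\<in>{1..N}. 2 * u i s * drift i s) \<le> (real N)\<^sup>2 + 2 * d * gap s" if "s \<in> {0..T}" for s
  proof -
    have "(\<Sum>i\<in>{1..N}. (u i s - x i s) * drift i s) \<le> d * gap s"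
      using sum_drift_bound[of "\<lambda>i. u i s - x i s" d s] close that by simp
    moreover have "(\<Sum>i\<in>{1..N}. 2 * u i s * drift i s) =
        2 * (\<Sum>i\<in>{1..N}. (u i s - x i s) * drift i s) + 2 * (\<Sum>i\<in>{1..N}. x i s * drift i s)"
      by (simp add: sum_distrib_left sum.distrib[symmetric] algebra_simps)
    ultimately show ?thesis using sum_x_drift[of s] by linarith
  qed
  have c: "set_integrable lborel {0..t} (\<lambda>s. (real N)\<^sup>2)"
    by (intro borel_integrable_atLeastAtMost') simp
  have g: "set_integrable lborel {0..t} (\<lambda>s. 2 * d * gap s)"
    using gap_integrable[of t] t by simp
  have "?Q t - ?Q 0 = (LINT s:{0..t}|lborel. (\<Sum>i\<in>{1..N}. 2 * u i s * drift i s))"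
    using abs_cont_onD[OF Q, of t] t by simp
  also have "\<dots> \<le> (LINT s:{0..t}|lborel. (real N)\<^sup>2 + 2 * d * gap s)"
    using le t c g by (intro set_integral_mono_AE_lborel abs_cont_on_integrable[OF Q] set_integral_add AE_I2) auto
  also have "\<dots> = (real N)\<^sup>2 * t + 2 * d * ?G"
    using c g t by (simp add: set_integral_add) (simp add: set_lebesgue_integral_def)
  also have "\<dots> \<le> (real N)\<^sup>2 * T + 2 * d * (2 * real N * (2 * real N + ?Q t + A2))"
    using t d0 gap_integral_le[OF t] by (intro add_mono mult_left_mono) auto
  also have "2 * d * (2 * real N * (2 * real N + ?Q t + A2)) = 8 * real N * d * ((2 * real N + ?Q t + A2) / 2)"
    by (simp add: algebra_simps)
  also have "\<dots> \<le> 1 * ((2 * real N + ?Q t + A2) / 2)"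
    using d1 A2_nonneg by (intro mult_right_mono) (auto intro!: sum_nonneg add_nonneg_nonneg)
  finally have "?Q t - A2 \<le> (real N)\<^sup>2 * T + (2 * real N + ?Q t + A2) / 2"
    by (simp add: u0 A2_def)
  then show ?thesis unfolding K_def by argo
qed

lemma gap_integral_le': "(LINT s:{0..t}|lborel. gap s) \<le> \<Gamma>" if t: "t \<in> {0..T}"
proof -
  have "2 * real N * (2 * real N + (\<Sum>i\<in>{1..N}. (u i t)\<^sup>2) + A2) \<le> \<Gamma>"
    unfolding \<Gamma>_def using sum_u_sq_le[OF t] by (intro mult_left_mono) auto
  then show ?thesis using gap_integral_le[OF t] by linarith
qed

lemma u_bound: "\<bar>u i t\<bar> \<le> 1 + K" if "i \<in> {1..N}" "t \<in> {0..T}"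
proof -
  have "(u i t)\<^sup>2 \<le> (\<Sum>i\<in>{1..N}. (u i t)\<^sup>2)"
    using that by (intro member_le_sum) auto
  then show ?thesis using sum_u_sq_le[OF that(2)] abs_le_one_plus_square[of "u i t"] by linarith
qed

lemma x_bound: "\<bar>x i t\<bar> \<le> 2 + K" if "i \<in> {1..N}" "t \<in> {0..T}"
proof -
  have "8 * d \<le> 8 * real N * d"
    using N d0 by (simp add: mult_right_mono)
  then have "d \<le> 1" using d1 by simp
  then show ?thesis using u_bound[OF that] close[OF that] by linarith
qed

section \<open>Comparison of the elementary symmetric polynomials with their limits\<close>

lemma esym_u_x:
  assumes "A \<subseteq> {1..N}" "t \<in> {0..T}"
  shows "\<bar>esym A k (\<lambda>i. u i t) - esym A k (\<lambda>i. x i t)\<bar> \<le> L * d"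
proof -
  have A: "finite A" "card A \<le> N"
    using assms(1) finite_subset card_mono[of "{1..N}" A] by auto
  have "\<bar>esym A k (\<lambda>i. u i t) - esym A k (\<lambda>i. x i t)\<bar> \<le> (2 + (2 + K)) ^ card A * d"
  proof (intro esym_bound_lipschitz[THEN conjunct2])
    fix i assume "i \<in> A"
    then have i: "i \<in> {1..N}" using assms(1) by blast
    show "\<bar>u i t\<bar> \<le> 2 + K" using u_bound[OF i assms(2)] by simp
    show "\<bar>x i t\<bar> \<le> 2 + K" "\<bar>u i t - x i t\<bar> \<le> d" by (fact x_bound[OF i assms(2)] close[OF i assms(2)])+
  qed (use A K_nonneg d0 in auto)
  also have "\<dots> \<le> L * d"
    unfolding L_def using A K_nonneg d0 by (intro mult_right_mono) (auto intro!: power_increasing)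
  finally show ?thesis .
qed

text \<open>With E_k the error at level k, integrating the system gives E_(k+2) \<le> W d + V E_k.
  Levels 0 and 1, where the two-step induction starts, are exact.\<close>

lemma esym_u_m:
  assumes "k \<le> N" "t \<in> {0..T}"
  shows "\<bar>esym {1..N} k (\<lambda>i. u i t) - m k t\<bar> \<le> W * (1 + V) ^ k * d"
  using assms
proof (induction k arbitrary: t rule: induct_nat_012)
  case 0
  then show ?case using m_0 W_nonneg V_nonneg d0 by simp
next
  case 1
  \<comment> \<open>By antisymmetry the components of the drift add up to 0, so e_1 is
    conserved.\<close>
  have "(\<Sum>i\<in>{1..N}. esym ({1..N} - {i}) 0 (\<lambda>i. u i s) * drift i s) = 0" for s
    using sum_drift_antisym[of "\<lambda>_. 1" s] by simp
  then have "abs_cont_on T (\<lambda>t. esym {1..N} 1 (\<lambda>i. u i t)) (\<lambda>_. 0)"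
    using abs_cont_on_esym[of "{1..N}" T u drift 0] u_drift by simp
  from abs_cont_onD[OF this, of t] have "esym {1..N} 1 (\<lambda>i. u i t) = esym {1..N} 1 (\<lambda>i. u i 0)"
    using 1 by (simp add: set_lebesgue_integral_def)
  also have "\<dots> = esym {1..N} 1 a"
    unfolding esym_def using u0 by (intro sum.cong prod.cong) auto
  finally show ?case using 1 m_1 W_nonneg V_nonneg d0 by simp
next
  case (ge2 k)
  let ?c = "(real N - real k) * (real N - real k - 1) / 2"
  let ?E = "W * (1 + V) ^ k * d"
  let ?u = "\<lambda>s i. u i s" and ?x = "\<lambda>s i. x i s"
  have k: "k + 2 \<le> N" using ge2 by simp
  have c: "0 \<le> ?c" "?c \<le> (real N)\<^sup>2"
  proof -
    show "0 \<le> ?c" using k by simp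
    have "(real N - real k) * (real N - real k - 1) \<le> real N * real N"
      using k by (intro mult_mono) auto
    then show "?c \<le> (real N)\<^sup>2" using zero_le_square[of "real N"] unfolding power2_eq_square by linarith
  qed
  define f where "f s = (\<Sum>i\<in>{1..N}. esym ({1..N} - {i}) (Suc k) (?u s) * drift i s) + ?c * m k s" for s
  \<comment> \<open>The first term pays for taking the coefficients at \<open>u\<close> but the
    drift at \<open>x\<close>. In the second, e_k is moved from \<open>x\<close> to \<open>u\<close>
    at the cost \<open>L * d\<close> and from \<open>u\<close> to the limit at the cost
    \<open>?E\<close>; the square of \<open>N\<close> bounds \<open>?c\<close>.\<close>
  define h where "h s = L * d * gap s + (real N)\<^sup>2 * (L * d + ?E)" for s
  have ac: "abs_cont_on T (\<lambda>t. esym {1..N} (k + 2) (?u t) - m (k + 2) t) f"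
    using abs_cont_on_diff[OF abs_cont_on_esym[of "{1..N}" T u drift "Suc k"] m_rec[OF k]] u_drift
    by (simp add: f_def[abs_def])
  have g: "set_integrable lborel {0..t} (\<lambda>s. L * d * gap s)" if "t \<le> T" for t
    using gap_integrable[OF that] by simp
  have ci: "set_integrable lborel {0..t} (\<lambda>s. (real N)\<^sup>2 * (L * d + ?E))" for t :: real
    by (intro borel_integrable_atLeastAtMost') simp
  have h: "set_integrable lborel {0..T} h"
    unfolding h_def[abs_def] using g ci by (intro set_integral_add) auto
  have "AE s in lborel. s \<in> {0..T} \<longrightarrow> \<bar>f s\<bar> \<le> h s"
    using distinct
  proof eventually_elim
    case (elim s)
    show ?case
    proof
      assume s: "s \<in> {0..T}"
      have "(\<Sum>i\<in>{1..N}. esym ({1..N} - {i}) (Suc k) (?x s) * drift i s) = - ?c * esym {1..N} k (?x s)"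
        unfolding drift_def using elim s drift_esym[of "{1..N}" "?x s" k] by simp
      then have "f s = (\<Sum>i\<in>{1..N}. (esym ({1..N} - {i}) (Suc k) (?u s) - esym ({1..N} - {i}) (Suc k) (?x s)) * drift i s)
          + ?c * ((esym {1..N} k (?u s) - esym {1..N} k (?x s)) - (esym {1..N} k (?u s) - m k s))"
        by (simp add: f_def left_diff_distrib sum_subtractf right_diff_distrib)
      moreover have "\<bar>\<Sum>i\<in>{1..N}. (esym ({1..N} - {i}) (Suc k) (?u s) - esym ({1..N} - {i}) (Suc k) (?x s)) * drift i s\<bar> \<le> L * d * gap s"
        using s by (intro sum_drift_bound esym_u_x) auto
      moreover have "\<bar>?c * ((esym {1..N} k (?u s) - esym {1..N} k (?x s)) - (esym {1..N} k (?u s) - m k s))\<bar> \<le>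
          (real N)\<^sup>2 * (L * d + ?E)"
      proof -
        have "\<bar>(esym {1..N} k (?u s) - esym {1..N} k (?x s)) - (esym {1..N} k (?u s) - m k s)\<bar> \<le> L * d + ?E"
          using esym_u_x[of "{1..N}" s k] ge2.IH(1)[OF _ s] s k by simp
        then show ?thesis unfolding abs_mult using c by (intro mult_mono) auto
      qed
      ultimately show "\<bar>f s\<bar> \<le> h s" by (simp add: h_def)
    qed
  qed
  from abs_cont_on_bound[OF ac h this] have
    "\<bar>esym {1..N} (k + 2) (?u t) - m (k + 2) t - (esym {1..N} (k + 2) (?u 0) - m (k + 2) 0)\<bar> \<le>
      (LINT s:{0..t}|lborel. h s)"
    using ge2.prems by simp
  moreover have "esym {1..N} (k + 2) (?u 0) - m (k + 2) 0 = 0"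
  proof -
    have "esym {1..N} (k + 2) (?u 0) = esym {1..N} (k + 2) a"
      unfolding esym_def using u0 by (intro sum.cong prod.cong) auto
    then show ?thesis using m_start[OF k] by simp
  qed
  moreover have "(LINT s:{0..t}|lborel. h s) = L * d * (LINT s:{0..t}|lborel. gap s) + (real N)\<^sup>2 * (L * d + ?E) * t"
    unfolding h_def using g[of t] ci ge2.prems
    by (subst set_integral_add) (auto simp: set_lebesgue_integral_def)
  moreover have "L * d * (LINT s:{0..t}|lborel. gap s) \<le> L * d * \<Gamma>"
    using ge2.prems L_nonneg d0 by (intro mult_left_mono gap_integral_le') auto
  moreover have "(real N)\<^sup>2 * (L * d + ?E) * t \<le> (real N)\<^sup>2 * (L * d + ?E) * T"
    using ge2.prems L_nonneg W_nonneg V_nonneg d0 by (intro mult_left_mono) auto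
  ultimately have "\<bar>esym {1..N} (k + 2) (?u t) - m (k + 2) t\<bar> \<le> L * d * \<Gamma> + V * (L * d + ?E)"
    by (simp add: V_def algebra_simps)
  also have "\<dots> = W * d * (1 + V * (1 + V) ^ k)"
    by (simp add: W_def algebra_simps)
  also have "\<dots> \<le> W * d * (1 + V) ^ (k + 2)"
  proof (intro mult_left_mono)
    have "1 \<le> (1 + V) ^ k" using V_nonneg by simp
    moreover have "0 \<le> V * (1 + V) ^ k" "0 \<le> V * V * (1 + V) ^ k" using V_nonneg by simp_all
    moreover have "(1 + V) ^ (k + 2) = (1 + V) ^ k + 2 * (V * (1 + V) ^ k) + V * V * (1 + V) ^ k"
      by (simp add: power_add power2_eq_square algebra_simps)
    ultimately show "1 + V * (1 + V) ^ k \<le> (1 + V) ^ (k + 2)" by linarith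
    show "0 \<le> W * d" using W_nonneg d0 by simp
  qed
  finally show ?case by (simp add: mult_ac)
qed

lemma esym_x_m:
  assumes "k \<le> N" "t \<in> {0..T}"
  shows "\<bar>esym {1..N} k (\<lambda>i. x i t) - m k t\<bar> \<le> (W * (1 + V) ^ N + L) * d"
proof -
  have "W * (1 + V) ^ k * d \<le> W * (1 + V) ^ N * d"
    using assms W_nonneg V_nonneg d0 by (intro mult_right_mono mult_left_mono power_increasing) auto
  then show ?thesis
    using esym_u_m[OF assms] esym_u_x[OF order_refl assms(2), of k] by (simp add: algebra_simps)
qed

end

section \<open>Convergence in probability\<close>

text \<open>A finite integral with the convention 1 / 0 = \<infinity> excludes coincidences up to a
  null set and dominates the real integrand, for which 1 / 0 = 0.\<close>

lemma inverse_gap_integrable: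
  fixes f g :: "real \<Rightarrow> real"
  assumes "continuous_on {0..T} f" "continuous_on {0..T} g"
    and fin: "(\<integral>\<^sup>+s\<in>{0..T}. 1 / ennreal \<bar>f s - g s\<bar> \<partial>lborel) < \<infinity>"
  shows "set_integrable lborel {0..T} (\<lambda>s. 1 / (f s - g s))"
    and "AE s in lborel. s \<in> {0..T} \<longrightarrow> f s \<noteq> g s"
proof -
  \<comment> \<open>Cut off to 0 outside \<open>{0..T}\<close>, where nothing is known about
    \<open>f\<close> and \<open>g\<close>; there \<open>1 / h s\<close> is 0 as well.\<close>
  define h where "h s = indicator {0..T} s *\<^sub>R (f s - g s)" for s
  have [measurable]: "h \<in> borel_measurable borel"
    unfolding h_def[abs_def] using assms(1,2)
    by (intro borel_measurable_continuous_on_indicator continuous_on_diff) auto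
  have h1: "indicator {0..T} s *\<^sub>R (1 / (f s - g s)) = 1 / h s" for s
    by (simp add: h_def indicator_def)
  have h2: "1 / ennreal \<bar>f s - g s\<bar> * indicator {0..T} s = 1 / ennreal \<bar>h s\<bar> * indicator {0..T} s" for s
    by (simp add: h_def indicator_def)
  have fin': "(\<integral>\<^sup>+s. 1 / ennreal \<bar>h s\<bar> * indicator {0..T} s \<partial>lborel) < \<infinity>"
    using fin unfolding h2 .
  show "set_integrable lborel {0..T} (\<lambda>s. 1 / (f s - g s))"
    unfolding set_integrable_def h1
  proof (rule integrableI_bounded)
    have "ennreal (norm (1 / h s)) \<le> 1 / ennreal \<bar>h s\<bar> * indicator {0..T} s" for s
    proof (cases "h s = 0")
      case False
      then have "s \<in> {0..T}" by (auto simp: h_def indicator_def split: if_splits)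
      moreover have "ennreal (norm (1 / h s)) = 1 / ennreal \<bar>h s\<bar>"
        using False divide_ennreal[of 1 "\<bar>h s\<bar>"] by simp
      ultimately show ?thesis by simp
    qed simp
    then show "(\<integral>\<^sup>+s. ennreal (norm (1 / h s)) \<partial>lborel) < \<infinity>"
      by (intro order_le_less_trans[OF nn_integral_mono fin'])
  qed measurable
  have "AE s in lborel. 1 / ennreal \<bar>h s\<bar> * indicator {0..T} s \<noteq> \<infinity>"
    using fin' by (intro nn_integral_PInf_AE) auto
  then show "AE s in lborel. s \<in> {0..T} \<longrightarrow> f s \<noteq> g s"
  proof eventually_elim
    case (elim s)
    show ?case
    proof (intro impI notI)
      assume "s \<in> {0..T}" "f s = g s"
      then have "1 / ennreal \<bar>h s\<bar> * indicator {0..T} s = \<infinity>"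
        by (simp add: h_def ennreal_divide_zero)
      then show False using elim by contradiction
    qed
  qed
qed

section \<open>Deterministic stability under small forcing\<close>

text \<open>The equation for one outcome on a finite time interval. The forcing \<open>w\<close> is
  any function, so the estimates become deterministic statements about the size of
  \<open>w\<close>.\<close>

definition dyson_path_solution ::
    "nat \<Rightarrow> (nat \<Rightarrow> real) \<Rightarrow> real \<Rightarrow> (nat \<Rightarrow> real \<Rightarrow> real) \<Rightarrow> (nat \<Rightarrow> real \<Rightarrow> real) \<Rightarrow> bool" where
  "dyson_path_solution N a T w x \<longleftrightarrow>
     (\<forall>i\<in>{1..N}. continuous_on {0..T} (x i)) \<and>
     (\<forall>t\<in>{0..T}. mono_on {1..N} (\<lambda>i. x i t)) \<and>
     (\<forall>i\<in>{1..N}. \<forall>j\<in>{1..N} - {i}. (\<integral>\<^sup>+s\<in>{0..T}. 1 / ennreal \<bar>x i s - x j s\<bar> \<partial>lborel) < \<infinity>) \<and>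
     (\<forall>i\<in>{1..N}. \<forall>t\<in>{0..T}. x i t = a i + w i t
        + (LINT s:{0..t}|lborel. (\<Sum>j\<in>{1..N} - {i}. 1 / (x i s - x j s))))"

lemma dyson_path_if_solution:
  assumes sol: "dyson_path_solution N a T w x"
    and w: "\<And>i t. i \<in> {1..N} \<Longrightarrow> t \<in> {0..T} \<Longrightarrow> \<bar>w i t\<bar> \<le> d"
    and T: "T \<ge> 0" and d: "d \<ge> 0" "8 * real N * d \<le> 1" and N: "N \<ge> 1"
    and m: "\<And>t. t \<in> {0..T} \<Longrightarrow> m 0 t = 1" "\<And>t. t \<in> {0..T} \<Longrightarrow> m 1 t = esym {1..N} 1 a"
      "\<And>k. k \<le> N \<Longrightarrow> m k 0 = esym {1..N} k a"
      "\<And>k. k + 2 \<le> N \<Longrightarrow>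
      abs_cont_on T (m (k + 2)) (\<lambda>t. - ((real N - real k) * (real N - real k - 1) / 2) * m k t)"
  shows "dyson_path N T d a x
    (\<lambda>i t. a i + (LINT s:{0..t}|lborel. (\<Sum>j\<in>{1..N} - {i}. 1 / (x i s - x j s)))) m"
proof -
  have gap: "set_integrable lborel {0..T} (\<lambda>s. 1 / (x i s - x j s))"
    "AE s in lborel. s \<in> {0..T} \<longrightarrow> x i s \<noteq> x j s" if "i \<in> {1..N}" "j \<in> {1..N} - {i}" for i j
  proof -
    have "continuous_on {0..T} (x i)" "continuous_on {0..T} (x j)"
      "(\<integral>\<^sup>+s\<in>{0..T}. 1 / ennreal \<bar>x i s - x j s\<bar> \<partial>lborel) < \<infinity>"
      using sol that unfolding dyson_path_solution_def by blast+
    from inverse_gap_integrable[OF this]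
    show "set_integrable lborel {0..T} (\<lambda>s. 1 / (x i s - x j s))"
      "AE s in lborel. s \<in> {0..T} \<longrightarrow> x i s \<noteq> x j s" .
  qed
  have int0: "(LINT s:{0..0}|lborel. f s) = 0" for f :: "real \<Rightarrow> real"
  proof -
    have "AE s in lborel. s \<noteq> (0 :: real)" by (rule AE_lborel_singleton)
    then have "AE s in lborel. indicator {0..0} s *\<^sub>R f s = 0"
      by eventually_elim (auto simp: indicator_def)
    then show ?thesis unfolding set_lebesgue_integral_def by (rule integral_eq_zero_AE)
  qed
  have drift: "set_integrable lborel {0..T} (\<lambda>s. \<Sum>j\<in>{1..N} - {i}. 1 / (x i s - x j s))" if "i \<in> {1..N}" for i
    unfolding set_integrable_def scaleR_sum_right
    using gap(1)[OF that] by (intro Bochner_Integration.integrable_sum) (simp add: set_integrable_def)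
  show ?thesis
  proof
    show "AE s in lborel. s \<in> {0..T} \<longrightarrow> inj_on (\<lambda>i. x i s) {1..N}"
    proof -
      have "AE s in lborel. \<forall>i\<in>{1..N}. \<forall>j\<in>{1..N} - {i}. s \<in> {0..T} \<longrightarrow> x i s \<noteq> x j s"
        by (intro AE_finite_allI gap(2)) auto
      then show ?thesis
        by eventually_elim (auto simp: inj_on_def)
    qed
    show "abs_cont_on T (\<lambda>t. a i + (LINT s:{0..t}|lborel. (\<Sum>j\<in>{1..N} - {i}. 1 / (x i s - x j s))))
        (\<lambda>s. \<Sum>j\<in>{1..N} - {i}. 1 / (x i s - x j s))" if "i \<in> {1..N}" for i
      using drift[OF that] by (intro abs_cont_onI) (simp_all only: int0 add_0_right)
    show "\<bar>a i + (LINT r:{0..s}|lborel. (\<Sum>j\<in>{1..N} - {i}. 1 / (x i r - x j r))) - x i s\<bar> \<le> d"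
      if "i \<in> {1..N}" "s \<in> {0..T}" for i s
    proof -
      have "x i s = a i + w i s + (LINT r:{0..s}|lborel. (\<Sum>j\<in>{1..N} - {i}. 1 / (x i r - x j r)))"
        using sol that unfolding dyson_path_solution_def by blast
      then show ?thesis using w[OF that] by simp
    qed
  qed (use sol T d N m gap(1) int0 in \<open>auto simp: dyson_path_solution_def\<close>)
qed

text \<open>How small the forcing has to be must not depend on the path, since \<open>d\<close> is
  later used for all outcomes and all \<beta>. It is chosen after \<open>\<rho>\<close>, which
  compactness provides for \<open>\<eta>\<close>.\<close>

lemma dyson_path_close:
  fixes a z :: "nat \<Rightarrow> real" and y :: "real \<Rightarrow> nat \<Rightarrow> real"
  assumes N: "N \<ge> 2" and z: "inj_on z {1..N}" "z ` {1..N} = {x. poly (hermite_prob N) x = 0}"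
    and y: "\<And>t. t \<ge> 0 \<Longrightarrow> is_finite_free_conv N a (\<lambda>k. sqrt t * z k) (y t)"
    and T: "T \<ge> 0" and \<eta>: "\<eta> > 0"
  obtains d where "d > 0" "\<And>w x i t. dyson_path_solution N a T w x \<Longrightarrow>
    (\<And>i t. i \<in> {1..N} \<Longrightarrow> t \<in> {0..T} \<Longrightarrow> \<bar>w i t\<bar> \<le> d) \<Longrightarrow> i \<in> {1..N} \<Longrightarrow> t \<in> {0..T} \<Longrightarrow>
    \<bar>x i t - y t i\<bar> \<le> \<eta>"
proof -
  define m where "m k t = esym {1..N} k (y t)" for k t
  note conv = esym_hermite_conv[OF N z y]
  have m: "\<And>t. t \<in> {0..T} \<Longrightarrow> m 0 t = 1" "\<And>t. t \<in> {0..T} \<Longrightarrow> m 1 t = esym {1..N} 1 a"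
      "\<And>k. k \<le> N \<Longrightarrow> m k 0 = esym {1..N} k a"
      "\<And>k. k + 2 \<le> N \<Longrightarrow>
      abs_cont_on T (m (k + 2)) (\<lambda>t. - ((real N - real k) * (real N - real k - 1) / 2) * m k t)"
    using conv by (simp_all add: m_def[abs_def])
  have "\<exists>R. \<forall>t\<in>{0..T}. \<forall>i\<in>{1..N}. \<bar>y t i\<bar> \<le> R"
  proof -
    have "continuous_on {0..T} (m 2)"
      using abs_cont_on_continuous[OF m(4)[of 0]] N by (simp add: numeral_2_eq_2)
    then have "bounded (m 2 ` {0..T})"
      by (intro compact_imp_bounded compact_continuous_image) auto
    then obtain B where "\<forall>r\<in>m 2 ` {0..T}. norm r \<le> B"
      unfolding bounded_iff by blast
    then have B: "\<bar>m 2 t\<bar> \<le> B" if "t \<in> {0..T}" for t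
      using that by simp
    have "\<bar>y t i\<bar> \<le> sqrt ((esym {1..N} 1 a)\<^sup>2 + 2 * B)" if "t \<in> {0..T}" "i \<in> {1..N}" for t i
    proof -
      have "(y t i)\<^sup>2 \<le> (\<Sum>i\<in>{1..N}. (y t i)\<^sup>2)"
        using that by (intro member_le_sum) auto
      also have "\<dots> = (m 1 t)\<^sup>2 - 2 * m 2 t"
        by (simp add: sum_squares_esym m_def)
      also have "\<dots> \<le> (esym {1..N} 1 a)\<^sup>2 + 2 * B"
        using m(2)[OF that(1)] B[OF that(1)] by auto
      finally show ?thesis by (simp add: real_le_rsqrt)
    qed
    then show ?thesis by blast
  qed
  then obtain R where R: "\<And>t i. t \<in> {0..T} \<Longrightarrow> i \<in> {1..N} \<Longrightarrow> \<bar>y t i\<bar> \<le> R"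
    by blast
  define K' where "K' = dyson_path.K N T a"
  \<comment> \<open>The constants of the locale are available before any path is given, but their
    signs are not; the absolute value makes \<open>C\<close> nonnegative.\<close>
  define C where "C = \<bar>dyson_path.W N T a * (1 + dyson_path.V N T) ^ N + dyson_path.L N T a\<bar>"
  obtain \<rho> where \<rho>: "\<rho> > 0"
    "\<And>x y i. mono_on {1..N} x \<Longrightarrow> mono_on {1..N} y \<Longrightarrow>
      (\<And>i. i \<in> {1..N} \<Longrightarrow> \<bar>x i\<bar> \<le> max R (2 + K')) \<Longrightarrow> (\<And>i. i \<in> {1..N} \<Longrightarrow> \<bar>y i\<bar> \<le> max R (2 + K')) \<Longrightarrow>
      (\<And>k. k \<in> {1..N} \<Longrightarrow> \<bar>esym {1..N} k x - esym {1..N} k y\<bar> \<le> \<rho>) \<Longrightarrow> i \<in> {1..N} \<Longrightarrow>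
      \<bar>x i - y i\<bar> \<le> \<eta>"
    using sorted_tuples_close_if_esym_close[OF \<eta>, of N "max R (2 + K')"] by blast
  \<comment> \<open>The first bound is the smallness condition of the locale, the second gives
    \<open>C * d \<le> \<rho>\<close>; \<open>C + 1\<close> avoids a zero denominator.\<close>
  define d where "d = min (1 / (8 * real N)) (\<rho> / (C + 1))"
  have C: "C \<ge> 0" by (simp add: C_def)
  have d: "d > 0" "8 * real N * d \<le> 1" "C * d \<le> \<rho>"
  proof -
    show "d > 0" using N \<rho>(1) C by (simp add: d_def)
    have "d \<le> 1 / (8 * real N)" by (simp add: d_def)
    then show "8 * real N * d \<le> 1" using N by (simp add: field_simps)
    have "d \<le> \<rho> / (C + 1)" by (simp add: d_def)
    then have "(C + 1) * d \<le> \<rho>" using C by (simp add: field_simps)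
    then show "C * d \<le> \<rho>" using \<open>d > 0\<close> by (simp add: algebra_simps)
  qed
  show thesis
  proof (rule that[OF d(1)])
    fix w x i t
    assume sol: "dyson_path_solution N a T w x"
      and w: "\<And>i t. i \<in> {1..N} \<Longrightarrow> t \<in> {0..T} \<Longrightarrow> \<bar>w i t\<bar> \<le> d"
      and i: "i \<in> {1..N}" and t: "t \<in> {0..T}"
    interpret dyson_path N T d a x
      "\<lambda>i t. a i + (LINT s:{0..t}|lborel. (\<Sum>j\<in>{1..N} - {i}. 1 / (x i s - x j s)))" m
      using d N by (intro dyson_path_if_solution[OF sol w T] m) auto
    have "\<bar>esym {1..N} k (\<lambda>i. x i t) - esym {1..N} k (y t)\<bar> \<le> \<rho>" if "k \<in> {1..N}" for k
    proof -
      have "\<bar>esym {1..N} k (\<lambda>i. x i t) - m k t\<bar> \<le> (W * (1 + V) ^ N + L) * d"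
        using that t by (intro esym_x_m) auto
      also have "\<dots> \<le> C * d"
        using d(1) by (intro mult_right_mono) (auto simp: C_def)
      finally show ?thesis using d(3) by (simp add: m_def)
    qed
    moreover have "mono_on {1..N} (y t)"
      using y[of t] t by (simp add: is_finite_free_conv_def)
    moreover have "\<bar>x i t\<bar> \<le> max R (2 + K')" if "i \<in> {1..N}" for i
      using x_bound[OF that t] by (simp add: K'_def)
    moreover have "\<bar>y t i\<bar> \<le> max R (2 + K')" if "i \<in> {1..N}" for i
      using R[OF t that] by simp
    ultimately show "\<bar>x i t - y t i\<bar> \<le> \<eta>"
      using mono[OF t] i by (intro \<rho>(2)[of "\<lambda>i. x i t"]) auto
  qed
qed

section \<open>Passage from paths to probabilities\<close>

lemma dyson_path_solution_AE:
  assumes "dyson_strong_solution M N a \<beta> b x" "T \<ge> 0"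
  shows "AE w in M. dyson_path_solution N a T (\<lambda>i t. sqrt (2 / \<beta>) * b i t w) (\<lambda>i t. x i t w)"
proof -
  have AE: "AE w in M. \<forall>t\<ge>0. mono_on {1..N} (\<lambda>i. x i t w)"
    "AE w in M. \<forall>i\<in>{1..N}. \<forall>j\<in>{1..N} - {i}. \<forall>t\<ge>0.
        (\<integral>\<^sup>+s\<in>{0..t}. 1 / ennreal \<bar>x i s w - x j s w\<bar> \<partial>lborel) < \<infinity>"
    "AE w in M. \<forall>i\<in>{1..N}. \<forall>t\<ge>0. x i t w = a i + sqrt (2 / \<beta>) * b i t w
          + (LINT s:{0..t}|lborel. (\<Sum>j\<in>{1..N} - {i}. 1 / (x i s w - x j s w)))"
    and c: "\<forall>i\<in>{1..N}. \<forall>w\<in>space M. continuous_on {0..} (\<lambda>t. x i t w)"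
    using assms(1) unfolding dyson_strong_solution_def by blast+
  show ?thesis
    using AE AE_space
  proof eventually_elim
    case (elim w)
    have "continuous_on {0..T} (\<lambda>t. x i t w)" if "i \<in> {1..N}" for i
    proof (rule continuous_on_subset)
      show "continuous_on {0..} (\<lambda>t. x i t w)" using c that elim(4) by blast
    qed auto
    moreover have "mono_on {1..N} (\<lambda>i. x i t w)" if "t \<in> {0..T}" for t
      using elim(1) that by simp
    moreover have "(\<integral>\<^sup>+s\<in>{0..T}. 1 / ennreal \<bar>x i s w - x j s w\<bar> \<partial>lborel) < \<infinity>"
      if "i \<in> {1..N}" "j \<in> {1..N} - {i}" for i j
      using elim(2) that assms(2) by blast
    moreover have "x i t w = a i + sqrt (2 / \<beta>) * b i t w
          + (LINT s:{0..t}|lborel. (\<Sum>j\<in>{1..N} - {i}. 1 / (x i s w - x j s w)))"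
      if "i \<in> {1..N}" "t \<in> {0..T}" for i t
      using elim(3) that by auto
    ultimately show ?case unfolding dyson_path_solution_def by blast
  qed
qed

text \<open>Each continuous path is bounded on \<open>{0..T}\<close>, so the events of exceeding n
  decrease to the empty set and their probabilities tend to 0. They are formed over countably many
  times to be measurable; continuity extends the bound to all times.\<close>

lemma (in prob_space) continuous_paths_bounded_in_probability:
  fixes b :: "nat \<Rightarrow> real \<Rightarrow> 'a \<Rightarrow> real"
  assumes [measurable]: "\<And>i t. i \<in> {1..N} \<Longrightarrow> t \<in> {0..T} \<Longrightarrow> b i t \<in> borel_measurable M"
    and cont: "\<And>i w. i \<in> {1..N} \<Longrightarrow> w \<in> space M \<Longrightarrow> continuous_on {0..T} (\<lambda>t. b i t w)"
    and T: "T > 0" and e: "e > 0"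
  shows "\<exists>B\<in>sets M. \<exists>n. measure M B < e \<and>
    (\<forall>w\<in>space M - B. \<forall>i\<in>{1..N}. \<forall>t\<in>{0..T}. \<bar>b i t w\<bar> \<le> real n)"
proof -
  \<comment> \<open>Taken from the open interval: intersecting an open set with a dense set does not
    change its closure.\<close>
  define D where "D = {0<..<T} \<inter> \<rat>"
  have cl: "closure D = {0..T}"
    unfolding D_def using T by (subst closure_open_Int_superset) (auto simp: Rats_closure_real)
  have D: "D \<subseteq> {0..T}" "countable D"
    by (auto simp: D_def countable_rat)
  define B where "B n = (\<Union>i\<in>{1..N}. \<Union>t\<in>D. {w\<in>space M. \<bar>b i t w\<bar> > real n})" for n
  have B: "B n \<in> sets M" for n
    unfolding B_def
  proof (rule sets.finite_UN[OF finite_atLeastAtMost], rule sets.countable_UN'[OF D(2)], rule image_subsetI)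
    fix i t assume "i \<in> {1..N}" "t \<in> D"
    then have [measurable]: "b i t \<in> borel_measurable M" using D by auto
    show "{w\<in>space M. \<bar>b i t w\<bar> > real n} \<in> sets M" by measurable
  qed
  have "decseq B"
    unfolding B_def by (intro decseq_SucI UN_mono order_refl Collect_mono) auto
  moreover have "(\<Inter>n. B n) = {}"
  proof (rule ccontr)
    assume "(\<Inter>n. B n) \<noteq> {}"
    then obtain w where w: "\<And>n. w \<in> B n" by blast
    then have "w \<in> space M" by (auto simp: B_def)
    then have "bounded (\<Union>i\<in>{1..N}. (\<lambda>t. b i t w) ` {0..T})"
      by (intro bounded_UN ballI finite_atLeastAtMost compact_imp_bounded
        compact_continuous_image[OF cont] compact_Icc)
    then obtain r where r: "\<And>i t. i \<in> {1..N} \<Longrightarrow> t \<in> {0..T} \<Longrightarrow> \<bar>b i t w\<bar> \<le> r"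
      unfolding bounded_iff by force
    obtain n where "r < real n" using reals_Archimedean2 by blast
    moreover obtain i t where "i \<in> {1..N}" "t \<in> D" "\<bar>b i t w\<bar> > real n"
      using w[of n] by (auto simp: B_def)
    ultimately show False using r[of i t] D(1) by fastforce
  qed
  ultimately have "(\<lambda>n. measure M (B n)) \<longlonglongrightarrow> 0"
    using finite_Lim_measure_decseq[of B] B by auto
  then obtain n where n: "measure M (B n) < e"
    using order_tendstoD(2)[OF _ e] eventually_happens by (metis sequentially_bot)
  show ?thesis
  proof (intro bexI[OF _ B] exI conjI ballI)
    show "measure M (B n) < e" by (fact n)
    fix w i t assume w: "w \<in> space M - B n" and i: "i \<in> {1..N}" and t: "t \<in> {0..T}"
    have "continuous_on (closure D) (\<lambda>t. \<bar>b i t w\<bar>)"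
      unfolding cl using cont[OF i] w by (intro continuous_intros) auto
    then show "\<bar>b i t w\<bar> \<le> real n"
      by (rule continuous_le_on_closure) (use w i t in \<open>auto simp: cl B_def not_less\<close>)
  qed
qed

text \<open>The same \<open>b\<close> drives the equation for every \<beta>, so one exceptional
  event and one bound n on the Brownian paths serve all \<beta>; then
  \<open>sqrt (2 / \<beta>) * n\<close> falls below the tolerated forcing as \<beta> grows.\<close>

theorem theorem1p1:
  fixes N :: nat and a z :: "nat \<Rightarrow> real" and M :: "'w measure"
    and b :: "nat \<Rightarrow> real \<Rightarrow> 'w \<Rightarrow> real"
    and lam :: "real \<Rightarrow> nat \<Rightarrow> real \<Rightarrow> 'w \<Rightarrow> real"
    and y :: "real \<Rightarrow> nat \<Rightarrow> real"
    and T \<epsilon> :: real and i :: nat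
  assumes "N \<ge> 2"
    and "mono_on {1..N} a"
    and "prob_space M"
    and "independent_brownian_motions M N b"
    and "\<And>\<beta>. \<beta> > 0 \<Longrightarrow> dyson_strong_solution M N a \<beta> b (lam \<beta>)"
    and "strict_mono_on {1..N} z"
    and "z ` {1..N} = {x. poly (hermite_prob N) x = 0}"
    and "\<And>t. t \<ge> 0 \<Longrightarrow> is_finite_free_conv N a (\<lambda>k. sqrt t * z k) (y t)"
    and "T > 0" and "i \<in> {1..N}" and "\<epsilon> > 0"
  shows "((\<lambda>\<beta>. measure M {w \<in> space M. (SUP t\<in>{0..T}. \<bar>lam \<beta> i t w - y t i\<bar>) \<ge> \<epsilon>}) \<longlongrightarrow> 0) at_top"
proof (rule tendstoI)
  interpret prob_space M by fact
  fix e :: real assume e: "e > 0"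
  \<comment> \<open>Half of \<open>\<epsilon>\<close> keeps the supremum strictly below
    \<open>\<epsilon>\<close>.\<close>
  obtain d where d: "d > 0" "\<And>w x i t. dyson_path_solution N a T w x \<Longrightarrow>
      (\<And>i t. i \<in> {1..N} \<Longrightarrow> t \<in> {0..T} \<Longrightarrow> \<bar>w i t\<bar> \<le> d) \<Longrightarrow> i \<in> {1..N} \<Longrightarrow> t \<in> {0..T} \<Longrightarrow>
      \<bar>x i t - y t i\<bar> \<le> \<epsilon> / 2"
    using dyson_path_close[OF assms(1) strict_mono_on_imp_inj_on[OF assms(6)] assms(7,8), of T "\<epsilon> / 2"]
      assms(9,11) by (metis half_gt_zero less_imp_le)
  have bm: "standard_brownian_motion M (b i)" if "i \<in> {1..N}" for i
    using assms(4) that by (simp add: independent_brownian_motions_def)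
  have meas: "b i t \<in> borel_measurable M" if "i \<in> {1..N}" "t \<in> {0..T}" for i t
    using bm[OF that(1)] that(2) by (simp add: standard_brownian_motion_def)
  have cont: "continuous_on {0..T} (\<lambda>t. b i t w)" if "i \<in> {1..N}" "w \<in> space M" for i w
  proof (rule continuous_on_subset)
    show "continuous_on {0..} (\<lambda>t. b i t w)"
      using bm[OF that(1)] that(2) unfolding standard_brownian_motion_def by blast
  qed auto
  have "\<exists>B\<in>sets M. \<exists>n. measure M B < e \<and>
      (\<forall>w\<in>space M - B. \<forall>i\<in>{1..N}. \<forall>t\<in>{0..T}. \<bar>b i t w\<bar> \<le> real n)"
    by (intro continuous_paths_bounded_in_probability meas cont assms(9) e)
  then obtain B n where B: "B \<in> sets M" "measure M B < e"
      "\<And>w i t. w \<in> space M - B \<Longrightarrow> i \<in> {1..N} \<Longrightarrow> t \<in> {0..T} \<Longrightarrow> \<bar>b i t w\<bar> \<le> real n"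
    by blast
  have "((\<lambda>\<beta>. sqrt (2 / \<beta>) * real n) \<longlongrightarrow> 0) at_top"
    by real_asymp
  then have "\<forall>\<^sub>F \<beta> in at_top. sqrt (2 / \<beta>) * real n < d"
    using d(1) by (rule order_tendstoD)
  then show "\<forall>\<^sub>F \<beta> in at_top.
      dist (measure M {w \<in> space M. (SUP t\<in>{0..T}. \<bar>lam \<beta> i t w - y t i\<bar>) \<ge> \<epsilon>}) 0 < e"
    using eventually_gt_at_top[of 0]
  proof eventually_elim
    case (elim \<beta>)
    let ?S = "{w \<in> space M. (SUP t\<in>{0..T}. \<bar>lam \<beta> i t w - y t i\<bar>) \<ge> \<epsilon>}"
    have "AE w in M. w \<in> ?S \<longrightarrow> w \<in> B"
      using dyson_path_solution_AE[OF assms(5)[OF elim(2)] less_imp_le[OF assms(9)]] AE_space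
    proof eventually_elim
      case (elim w)
      show ?case
      proof (intro impI, rule ccontr)
        assume S: "w \<in> ?S" and "w \<notin> B"
        have small: "\<bar>sqrt (2 / \<beta>) * b i t w\<bar> \<le> d" if "i \<in> {1..N}" "t \<in> {0..T}" for i t
        proof -
          have "\<bar>sqrt (2 / \<beta>) * b i t w\<bar> \<le> sqrt (2 / \<beta>) * real n"
            using B(3)[of w, OF _ that] \<open>w \<notin> B\<close> elim(2) \<open>\<beta> > 0\<close>
            by (simp add: abs_mult mult_left_mono)
          then show ?thesis using \<open>sqrt (2 / \<beta>) * real n < d\<close> by linarith
        qed
        have "(SUP t\<in>{0..T}. \<bar>lam \<beta> i t w - y t i\<bar>) \<le> \<epsilon> / 2"
          using assms(9) d(2)[OF elim(1) small assms(10)] by (intro cSUP_least) auto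
        then show False using S assms(11) by simp
      qed
    qed
    \<comment> \<open>Monotonicity asks for measurability of the larger set \<open>B\<close>
      only.\<close>
    then have "measure M ?S \<le> measure M B"
      using B(1) by (rule finite_measure_mono_AE)
    then show ?case using B(2) by simp
  qed
qed

end
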